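(* Let $C_i$ be a sequence of self-dual binary codes with length $n(C_i)\to\infty$. Then \[ \limsup_{i\to\infty}\frac{d(C_i)}{n(C_i)}\le\frac{1-5^{-1/4}}{2}. \]
   Context: A binary linear code is self-dual if it equals its dual with respect to the standard inner product over $\mathbb{F}_2$; $d(C)$ is its minimum Hamming distance and $n(C)$ its length. *)

theory Defs
  imports
    "HOL-Library.Extended_Real"
    "HOL-Library.Z2"
    "Jordan_Normal_Form.VS_Connect"
begin

type_synonym binary_word = "bit Matrix.vec"

definition binary_linear_code :: "nat \<Rightarrow> binary_word set \<Rightarrow> bool" where
  "binary_linear_code n C \<longleftrightarrow> VectorSpace.subspace class_ring C (module_vec TYPE(bit) n)"

definition dual_code :: "nat \<Rightarrow> binary_word set \<Rightarrow> binary_word set" where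
  "dual_code n C = {x \<in> carrier_vec n. \<forall>c \<in> C. scalar_prod x c = 0}"

definition self_dual_code :: "nat \<Rightarrow> binary_word set \<Rightarrow> bool" where
  "self_dual_code n C \<longleftrightarrow> binary_linear_code n C \<and> C = dual_code n C"

definition hamming_distance :: "binary_word \<Rightarrow> binary_word \<Rightarrow> nat" where
  "hamming_distance x y = card {i. i < dim_vec x \<and> x $ i \<noteq> y $ i}"

text \<open>The value is unspecified if \<open>C\<close> has fewer than two words; a self-dual code
  has at least two words as soon as its length is positive.\<close>

definition minimum_distance :: "binary_word set \<Rightarrow> nat" where
  "minimum_distance C =
     Min {hamming_distance x y | x y. x \<in> C \<and> y \<in> C \<and> x \<noteq> y}"

lemma binary_linear_code_iff:
  "binary_linear_code n C \<longleftrightarrow>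
     C \<subseteq> carrier_vec n \<and> 0\<^sub>v n \<in> C \<and> (\<forall>x\<in>C. \<forall>y\<in>C. x + y \<in> C) \<and> (\<forall>a. \<forall>x\<in>C. a \<cdot>\<^sub>v x \<in> C)"
proof -
  interpret V: vec_space "TYPE(bit)" n .
  show ?thesis
    unfolding binary_linear_code_def VectorSpace.subspace_def submodule_def
    using V.vectorspace_axioms V.module_axioms
    by (auto simp: module_vec_simps)
qed

lemma self_dual_code_iff: "self_dual_code n C \<longleftrightarrow> C = dual_code n C"
proof -
  have "binary_linear_code n C" if C: "C = dual_code n C"
  proof -
    have sub: "C \<subseteq> carrier_vec n" using C by (auto simp: dual_code_def)
    have "binary_linear_code n (dual_code n C)"
      using sub unfolding binary_linear_code_iff
      by (auto simp: dual_code_def subset_iff add_scalar_prod_distrib[of _ n])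
    then show ?thesis using C by simp
  qed
  then show ?thesis by (auto simp: self_dual_code_def)
qed

end

(* Write the weight enumerator of a self-dual code of length n = 2h as a polynomial V in u = y^2.
   Gleason's theorem gives V = (1+u)^h * sum_j a_j t^j with t = u(1-u)^2/(1+u)^4, and the nonnegative
   shadow coefficients force (-1)^j a_j >= 0.  Hence a_{J+1} <= c a_J for even J and c >= 0.  Lagrange
   inversion turns a_{J+1} - c a_J into a linear functional of the weight distribution whose
   coefficients are, up to a shift of index, those of the power series Omega * Phi, with
   Omega = (1-6u+u^2)((1+u)^4 - c u(1-u)^2) and Phi = (1-u)^(-2J-3) (1+u)^(4J-h-1).  If the coefficient
   belonging to the zero word is positive and those belonging to weights >= d are nonnegative, this is
   a contradiction.  The signs are read off from the ratios of consecutive coefficients of Phi, which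
   satisfies a three-term recurrence: where the ratio is r, the sign is that of Omega(1/r).  For
   J ~ h/6 the ratio at the zero word tends to sqrt 5, and a suitable c exists iff the ratios at
   weights >= d exceed the other solution of t(1/r) = t(1/sqrt 5), that is, iff
   d/n > (1 - 5^(-1/4))/2.  This refines the argument of Mallows, Odlyzko and Sloane. *)
theory Submission
  imports
    Defs
    "HOL-Computational_Algebra.Computational_Algebra"
    "HOL-Real_Asymp.Real_Asymp"
begin

text \<open>With J = h/6 exactly, Phi would be (1+u)^2 times a power of 1/(1-u^2), and the ratios of
  consecutive coefficients would oscillate with the parity of the index. So J is pushed up by about
  2 sqrt h. This makes the coefficient p = 6J + 2 - h of the recurrence at least 12 sqrt h, which
  forces regular ratios, while p/h still tends to 0 and the limit sqrt 5 survives. Saddle-point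
  estimates are replaced by two monotonicity facts: the coefficients g_k of Phi are log-concave and
  the numbers k! g_k are log-convex in the relevant range. Together they give g_(k-i)/g_k = r^(-i) +
  O(1/k) with an explicit constant for i <= 6, so convolving with Omega amounts to evaluating Omega
  at 1/r. That error is useless for bounded k, but there r tends to infinity and the constant term 1
  of Omega decides. Gleason's theorem is obtained without invariant theory, from two reflections of
  one variable; the sign condition on the a_j comes from a kernel with nonnegative
  coefficients.\<close>

lemma poly_eq_sum_atMost:
  fixes P :: "real poly"
  assumes "degree P \<le> d"
  shows "poly P x = (\<Sum>i\<le>d. coeff P i * x ^ i)"
  unfolding poly_altdef using assms by (intro sum.mono_neutral_left) (auto simp: coeff_eq_0)

lemma poly_eq_off_finite:
  fixes P Q :: "real poly"
  assumes "\<And>u. u \<notin> F \<Longrightarrow> poly P u = poly Q u" "finite F"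
  shows "P = Q"
proof (rule ccontr)
  assume "P \<noteq> Q"
  then have "finite {u. poly (P - Q) u = 0}" by (intro poly_roots_finite) simp
  moreover have "UNIV \<subseteq> {u. poly (P - Q) u = 0} \<union> F" using assms(1) by auto
  ultimately have "finite (UNIV :: real set)" using assms(2) finite_subset by blast
  then show False by (simp add: infinite_UNIV_char_0)
qed

section \<open>Ratios of consecutive terms in a three-term recurrence\<close>

text \<open>In the application \<open>g\<close> is the coefficient sequence of
  \<open>\<Phi> N Q\<close>, with \<open>p = N - Q\<close> and \<open>m = N + Q\<close>; the
  recurrence is the differential equation \<open>\<Phi>_deriv\<close> read off coefficientwise. The
  last two assumptions are tailored to the induction in \<open>\<rho>_bounds\<close>, which reaches
  up to \<open>E\<close>.\<close>

locale three_term =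
  fixes g :: "nat \<Rightarrow> real" and p m :: real and E :: nat
  assumes g_0: "g 0 = 1" and g_1: "g 1 = p"
    and g_rec: "\<And>e. (real e + 2) * g (e + 2) = p * g (e + 1) + (m + real e) * g e"
    and p_pos: "p > 0" and m_ge: "m \<ge> 8" and p_sq: "p\<^sup>2 \<ge> 2 * (m + real E)"
begin

lemma g_pos: "g e > 0"
proof (induction e rule: less_induct)
  case (less e)
  consider "e = 0" | "e = 1" | k where "e = k + 2"
    by (metis add_2_eq_Suc' not0_implies_Suc One_nat_def)
  then show ?case
  proof cases
    case 3
    have "(real k + 2) * g (k + 2) > 0"
      unfolding g_rec using less[of k] less[of "k+1"] 3 p_pos m_ge
      by (intro add_pos_pos[of "p * g (k + 1)"] mult_pos_pos) auto
    then show ?thesis using 3 by (simp add: zero_less_mult_iff)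
  qed (use g_0 g_1 p_pos in auto)
qed

definition \<rho> :: "nat \<Rightarrow> real" where "\<rho> e = g (e + 1) / g e"

lemma \<rho>_pos: "\<rho> e > 0"
  by (simp add: \<rho>_def g_pos)

lemma \<rho>_0: "\<rho> 0 = p"
  using g_0 g_1 by (simp add: \<rho>_def)

lemma \<rho>_Suc: "(real e + 2) * (\<rho> (Suc e) * \<rho> e) = p * \<rho> e + m + real e"
proof -
  have "\<rho> (Suc e) * \<rho> e = g (e + 2) / g e"
    using g_pos[of "Suc e"] by (simp add: \<rho>_def)
  then have "(real e + 2) * (\<rho> (Suc e) * \<rho> e) = ((real e + 2) * g (e + 2)) / g e" by simp
  also have "\<dots> = p * \<rho> e + m + real e"
    unfolding g_rec using g_pos[of e] by (simp add: \<rho>_def field_simps)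
  finally show ?thesis .
qed

text \<open>The two bounds locate \<open>\<rho> e\<close> between the roots of two quadratics
  that differ by a unit shift of \<open>e\<close>; together they give log-concavity of \<open>g\<close>.\<close>

lemma \<rho>_bounds:
  assumes "e \<le> E"
  shows "(real e + 1) * (\<rho> e)\<^sup>2 \<le> p * \<rho> e + m + real e - 1 \<and>
         p * \<rho> e + m + real e \<le> (real e + 2) * (\<rho> e)\<^sup>2"
  using assms
proof (induction e)
  case 0
  then show ?case using p_sq m_ge by (simp add: \<rho>_0 power2_eq_square)
next
  case (Suc e)
  define r s M k where "r = \<rho> e" and "s = \<rho> (Suc e)" and "M = m + real e" and "k = real e + 2"
  have r: "r > 0" and s: "s > 0" by (simp_all add: r_def s_def \<rho>_pos)
  have M: "M \<ge> 8" using m_ge by (simp add: M_def)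
  have k2: "k \<ge> 2" by (simp add: k_def)
  have U: "(k - 1) * r\<^sup>2 \<le> p * r + M - 1" and L: "p * r + M \<le> k * r\<^sup>2"
    using Suc by (simp_all add: r_def M_def k_def algebra_simps)
  have step: "k * (s * r) = p * r + M"
    using \<rho>_Suc[of e] by (simp add: r_def s_def M_def k_def algebra_simps)
  have psq: "p\<^sup>2 \<ge> 2 * M" using p_sq Suc.prems by (simp add: M_def)
  have "k * (s * r) \<le> k * (r * r)" using step L by (simp add: power2_eq_square)
  then have sr: "s \<le> r" using r k2 by simp
  have "(k * s\<^sup>2) * r = (p * s + M) * r - M * (r - s)"
    using step by (simp add: algebra_simps power2_eq_square) (metis (no_types, lifting) mult.assoc mult.commute distrib_left)
  also have "\<dots> \<le> (p * s + M) * r" using M sr by simp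
  finally have 1: "k * s\<^sup>2 \<le> p * s + M" using r by simp
  \<comment> \<open>Eliminating \<open>s\<close> by \<open>step\<close> and multiplying by
    \<open>(k * r)\<^sup>2\<close> turns the lower bound for \<open>s\<close> into this inequality
    in \<open>r\<close> alone.\<close>
  have key: "p\<^sup>2 * r\<^sup>2 + (k + 2) * (p * M * r) + (k + 1) * M\<^sup>2 - (M + 1) * (k\<^sup>2 * r\<^sup>2) \<ge> 0"
  \<comment> \<open>The first index is separate because the estimate \<open>c\<close> below fails
    there: for \<open>k = 2\<close> its left side is -4.\<close>
  proof (cases "e = 0")
    case True
    then have rp: "r = p" and "k = 2" by (simp_all add: r_def \<rho>_0 k_def)
    have "p\<^sup>2 * r\<^sup>2 + (k + 2) * (p * M * r) + (k + 1) * M\<^sup>2 - (M + 1) * (k\<^sup>2 * r\<^sup>2)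
        = (p\<^sup>2 - 2)\<^sup>2 + 3 * M\<^sup>2 - 4"
      unfolding rp \<open>k = 2\<close> by (simp add: power2_eq_square algebra_simps)
    also have "\<dots> \<ge> 0"
    proof -
      have "M\<^sup>2 \<ge> 64" using mult_mono[of 8 M 8 M] M by (simp add: power2_eq_square)
      then show ?thesis using zero_le_power2[of "p\<^sup>2 - 2"] by linarith
    qed
    finally show ?thesis .
  next
    case False
    then have k3: "k \<ge> 3" by (simp add: k_def)
    have Mk: "M - k - 1 = m - 3" by (simp add: M_def k_def)
    have "(M + 1) * (k\<^sup>2 * ((k - 1) * r\<^sup>2)) \<le> (M + 1) * (k\<^sup>2 * (p * r + M - 1))"
      using U M by (intro mult_left_mono) auto
    have "p * r > 0" using p_pos r by simp
    have "k * r\<^sup>2 \<ge> M" using L \<open>p * r > 0\<close> by linarith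
    \<comment> \<open>The factor 2 in \<open>p_sq\<close> pays for replacing \<open>k\<close> by
      \<open>2 * (k - 1)\<close>.\<close>
    have kk: "(k - 1) * (p\<^sup>2 * r\<^sup>2) \<ge> M\<^sup>2 - 1"
    proof -
      have "2 * M * M \<le> p\<^sup>2 * (k * r\<^sup>2)"
        using psq \<open>k * r\<^sup>2 \<ge> M\<close> M by (intro mult_mono) auto
      moreover have "k * (p\<^sup>2 * r\<^sup>2) \<le> (2 * (k - 1)) * (p\<^sup>2 * r\<^sup>2)"
        using k2 by (intro mult_right_mono) auto
      ultimately show ?thesis by (simp add: algebra_simps power2_eq_square)
    qed
    \<comment> \<open>The constant 8 in \<open>m_ge\<close> originates here: for
      \<open>k = 3\<close> the left side is \<open>m - 8\<close>.\<close>
    have c: "(k - 1) * (M - k - 1) - (M + 1) \<ge> 0"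
    proof -
      have "(k - 1) * (M - k - 1) - (M + 1) = (k - 1) * (m - 4) - m"
        unfolding Mk by (simp add: M_def k_def algebra_simps)
      moreover have "2 * (m - 4) \<le> (k - 1) * (m - 4)"
        using k3 m_ge by (intro mult_right_mono) auto
      ultimately show ?thesis using m_ge by simp
    qed
    have "(k - 1) * (p\<^sup>2 * r\<^sup>2 + (k + 2) * (p * M * r) + (k + 1) * M\<^sup>2 - (M + 1) * (k\<^sup>2 * r\<^sup>2))
       = (k - 1) * (p\<^sup>2 * r\<^sup>2) - (M\<^sup>2 - 1) + (k\<^sup>2 - 1) + p * r * ((k - 1) * (M - k - 1) - (M + 1))
         + ((M + 1) * (k\<^sup>2 * (p * r + M - 1)) - (M + 1) * (k\<^sup>2 * ((k - 1) * r\<^sup>2)))"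
      by (simp add: algebra_simps power2_eq_square)
    also have "\<dots> \<ge> 0"
      using kk c \<open>p * r > 0\<close> k2 \<open>(M + 1) * (k\<^sup>2 * ((k - 1) * r\<^sup>2)) \<le> _\<close>
        mult_mono[of 1 k 1 k]
      by (intro add_nonneg_nonneg) (auto simp: power2_eq_square)
    finally show ?thesis using k2 by (simp add: zero_le_mult_iff)
  qed
  have "(k * r)\<^sup>2 * ((k + 1) * s\<^sup>2 - (p * s + M + 1))
      = (k + 1) * (k * (s * r))\<^sup>2 - p * (k * r) * (k * (s * r)) - (M + 1) * (k * r)\<^sup>2"
    by (simp add: algebra_simps power2_eq_square)
  also have "\<dots> = p\<^sup>2 * r\<^sup>2 + (k + 2) * (p * M * r) + (k + 1) * M\<^sup>2 - (M + 1) * (k\<^sup>2 * r\<^sup>2)"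
    unfolding step by (simp add: algebra_simps power2_eq_square)
  finally have "(k * r)\<^sup>2 * ((k + 1) * s\<^sup>2 - (p * s + M + 1)) \<ge> 0" using key by simp
  then have "p * s + M + 1 \<le> (k + 1) * s\<^sup>2"
    using k2 r by (simp add: zero_le_mult_iff)
  with 1 show ?case by (simp add: s_def M_def k_def algebra_simps)
qed

lemma \<rho>_antimono_step:
  assumes "e \<le> E"
  shows "\<rho> (Suc e) \<le> \<rho> e"
proof -
  have "(real e + 2) * (\<rho> (Suc e) * \<rho> e) \<le> (real e + 2) * (\<rho> e * \<rho> e)"
    using \<rho>_bounds[OF assms] \<rho>_Suc[of e] by (simp add: power2_eq_square algebra_simps)
  then show ?thesis using \<rho>_pos[of e] by simp
qed

text \<open>\<open>(real e + 1) * \<rho> e\<close> is the ratio of consecutive terms of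
  \<open>fact e * g e\<close>, so this is log-convexity of that sequence. It limits how fast the
  ratios of \<open>g\<close> can fall.\<close>

lemma \<rho>_scaled_mono_step:
  assumes "e \<le> E"
  shows "(real e + 1) * \<rho> e \<le> (real (Suc e) + 1) * \<rho> (Suc e)"
proof -
  have "((real e + 1) * \<rho> e) * \<rho> e \<le> ((real (Suc e) + 1) * \<rho> (Suc e)) * \<rho> e"
    using \<rho>_bounds[OF assms] \<rho>_Suc[of e] by (simp add: power2_eq_square algebra_simps)
  then show ?thesis using \<rho>_pos[of e] by simp
qed

lemma \<rho>_antimono: "i \<le> j \<Longrightarrow> j \<le> Suc E \<Longrightarrow> \<rho> j \<le> \<rho> i"
proof (induction j)
  case (Suc j)
  then show ?case using \<rho>_antimono_step[of j] by (cases "i = Suc j") auto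
qed simp

lemma \<rho>_scaled_mono: "i \<le> j \<Longrightarrow> j \<le> Suc E \<Longrightarrow> (real i + 1) * \<rho> i \<le> (real j + 1) * \<rho> j"
proof (induction j)
  case (Suc j)
  then show ?case using \<rho>_scaled_mono_step[of j] by (cases "i = Suc j") auto
qed simp

text \<open>\<open>g k\<close> is \<open>g (k - i)\<close> times the \<open>i\<close> ratios that
  end with \<open>\<rho> (k - 1)\<close>. Each is at least the last one, and by scaled monotonicity
  the one at \<open>k - 1 - l\<close> is at most \<open>\<rho> (k - 1)\<close> divided by
  \<open>1 - l / k\<close>. The product of these \<open>1 - l / k\<close> over \<open>l < i\<close>
  is at least one minus the sum of the \<open>l / k\<close>.\<close>

lemma g_shift_bounds:
  assumes "i \<le> k" "k \<le> Suc (Suc E)" "k > 0"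
  shows "g (k - i) * \<rho> (k - 1) ^ i \<le> g k \<and>
         (1 - real i * (real i - 1) / (2 * real k)) * g k \<le> g (k - i) * \<rho> (k - 1) ^ i"
  using assms(1)
proof (induction i)
  case 0
  then show ?case by simp
next
  case (Suc i)
  define r where "r = \<rho> (k - 1)"
  define t where "t = \<rho> (k - Suc i)"
  have r: "r > 0" and t: "t > 0" by (simp_all add: r_def t_def \<rho>_pos)
  have gki: "g (k - i) = t * g (k - Suc i)"
    using Suc.prems g_pos[of "k - Suc i"] by (simp add: t_def \<rho>_def Suc_diff_Suc)
  have rt: "r \<le> t" unfolding r_def t_def
    using Suc.prems assms by (intro \<rho>_antimono) auto
  have "(real (k - Suc i) + 1) * t \<le> (real (k - 1) + 1) * r"
    unfolding r_def t_def using Suc.prems assms by (intro \<rho>_scaled_mono) auto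
  then have tr: "(real k - real i) * t \<le> real k * r"
    using Suc.prems by (simp add: of_nat_diff)
  have G: "g (k - Suc i) > 0" "g k > 0" by (rule g_pos)+
  have 1: "g (k - Suc i) * r ^ Suc i \<le> g k"
  proof -
    have "g (k - Suc i) * r ^ Suc i \<le> g (k - i) * r ^ i"
      unfolding gki using rt r G by simp
    then show ?thesis using Suc by (simp add: r_def)
  qed
  have 2: "(1 - real (Suc i) * (real (Suc i) - 1) / (2 * real k)) * g k \<le> g (k - Suc i) * r ^ Suc i"
  proof -
    have k: "real k > 0" using assms by simp
    have ki: "0 < 1 - real i / real k" using Suc.prems by (simp add: field_simps)
    have "(1 - real i / real k) * t \<le> r" using tr k by (simp add: field_simps)
    then have "(1 - real i / real k) * (g (k - i) * r ^ i) \<le> g (k - Suc i) * r ^ Suc i"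
      unfolding gki using r G by (simp add: mult_ac mult_left_mono)
    moreover have "(1 - real i / real k) * ((1 - real i * (real i - 1) / (2 * real k)) * g k)
       \<le> (1 - real i / real k) * (g (k - i) * r ^ i)"
      using Suc ki by (intro mult_left_mono) (auto simp: r_def)
    moreover have "(1 - real (Suc i) * (real (Suc i) - 1) / (2 * real k)) * g k
       \<le> (1 - real i / real k) * ((1 - real i * (real i - 1) / (2 * real k)) * g k)"
    proof -
      have "(1 - real i / real k) * (1 - real i * (real i - 1) / (2 * real k))
         = 1 - real (Suc i) * (real (Suc i) - 1) / (2 * real k) + (real i / real k) * (real i * (real i - 1) / (2 * real k))"
        using k by (simp add: field_simps)
      moreover have "(real i / real k) * (real i * (real i - 1) / (2 * real k)) \<ge> 0"
        using k by (cases i) auto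
      ultimately show ?thesis
        unfolding mult.assoc[symmetric] using G by (intro mult_right_mono) linarith+
    qed
    ultimately show ?thesis by linarith
  qed
  from 1 2 show ?case by (simp add: r_def)
qed

section \<open>Convolution with a polynomial of degree at most 6\<close>

lemma conv_poly_eq:
  assumes "degree W \<le> d"
  shows "(\<Sum>i=0..k. coeff W i * g (k - i)) = g k * (\<Sum>i\<le>d. coeff W i * (if i \<le> k then g (k - i) / g k else 0))"
proof -
  have "(\<Sum>i=0..k. coeff W i * g (k - i)) = (\<Sum>i\<in>{..k} \<inter> {..d}. coeff W i * g (k - i))"
    using assms by (intro sum.mono_neutral_right) (auto simp: coeff_eq_0)
  also have "\<dots> = (\<Sum>i\<in>{..d} \<inter> {i. i \<le> k}. coeff W i * g (k - i))"
    by (intro sum.cong refl) auto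
  also have "\<dots> = g k * (\<Sum>i\<le>d. coeff W i * (if i \<le> k then g (k - i) / g k else 0))"
    using g_pos[of k] unfolding sum_distrib_left
    by (subst sum.inter_restrict) (auto intro!: sum.cong)
  finally show ?thesis .
qed

text \<open>The constant 15 is 6 * 5 / 2, the worst case of \<open>g_shift_bounds\<close> for
  \<open>i \<le> 6\<close>. For \<open>k < i\<close> the term is absent from the convolution, and
  the error bound is trivial because \<open>15 / k\<close> exceeds 1.\<close>

lemma g_quotient_bounds:
  assumes "i \<le> 6" "k \<le> Suc (Suc E)" "k > 0" "\<rho> (k - 1) \<ge> 1"
  defines "x \<equiv> (if i \<le> k then g (k - i) / g k else 0)"
  shows "0 \<le> x" "x \<le> (1 / \<rho> (k - 1)) ^ i" "(1 / \<rho> (k - 1)) ^ i - x \<le> 15 / k"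
proof -
  define r where "r = \<rho> (k - 1)"
  have r: "r > 0" "r \<ge> 1" using assms by (simp_all add: r_def \<rho>_pos)
  show "0 \<le> x" using g_pos by (auto simp: x_def less_imp_le)
  have "x \<le> (1 / r) ^ i \<and> (1 / r) ^ i - x \<le> 15 / k"
  proof (cases "i \<le> k")
    case True
    have gk: "g k > 0" by (rule g_pos)
    have b: "g (k - i) * r ^ i \<le> g k" "(1 - real i * (real i - 1) / (2 * real k)) * g k \<le> g (k - i) * r ^ i"
      using g_shift_bounds[OF True assms(2,3)] by (simp_all add: r_def)
    have 1: "x \<le> (1 / r) ^ i" using True b(1) gk r by (simp add: x_def power_one_over field_simps)
    have "real i * (real i - 1) \<le> 6 * 5"
    proof (cases "i = 0")
      case False
      then show ?thesis using assms(1) by (intro mult_mono) auto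
    qed simp
    then have "real i * (real i - 1) / (2 * real k) \<le> 15 / k"
      using divide_right_mono[of "real i * (real i - 1)" "6 * 5" "2 * real k"] by simp
    then have "(1 - 15 / k) * g k \<le> (1 - real i * (real i - 1) / (2 * real k)) * g k"
      using gk by (intro mult_right_mono) auto
    then have "(1 - 15 / k) * g k \<le> g (k - i) * r ^ i" using b(2) by linarith
    then have "1 - 15 / k \<le> x * r ^ i" using True gk by (simp add: x_def pos_le_divide_eq)
    then have "(1 / r) ^ i * (1 - 15 / k) \<le> (1 / r) ^ i * (x * r ^ i)" using r by (intro mult_left_mono) auto
    also have "(1 / r) ^ i * (x * r ^ i) = x" using r by (simp add: power_one_over)
    finally have "(1 / r) ^ i - x \<le> (1 / r) ^ i * (15 / k)" by (simp add: algebra_simps)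
    also have "\<dots> \<le> 1 * (15 / k)" using r by (intro mult_right_mono power_le_one) auto
    finally show ?thesis using 1 by simp
  next
    case False
    then have "(1 / r) ^ i \<le> 1" "15 / k \<ge> 1" using r assms by (auto intro!: power_le_one)
    then show ?thesis using False r by (simp add: x_def)
  qed
  then show "x \<le> (1 / \<rho> (k - 1)) ^ i" "(1 / \<rho> (k - 1)) ^ i - x \<le> 15 / k" by (simp_all add: r_def)
qed

text \<open>The first bound compares the convolution with the value of \<open>W\<close> at the
  reciprocal ratio and serves for large \<open>k\<close>. The second keeps only the constant
  coefficient and serves for small \<open>k\<close>, where \<open>\<rho> (k - 1)\<close> is
  large.\<close>

lemma conv_poly_lower:
  assumes W: "degree W \<le> 6" and k: "k \<le> Suc (Suc E)" "k > 0" and r: "\<rho> (k - 1) \<ge> 1"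
  defines "M \<equiv> (\<Sum>i\<le>6. \<bar>coeff W i\<bar>)"
  shows "g k * (poly W (1 / \<rho> (k - 1)) - 15 / k * M) \<le> (\<Sum>i=0..k. coeff W i * g (k - i))"
    and "g k * (coeff W 0 - M / \<rho> (k - 1)) \<le> (\<Sum>i=0..k. coeff W i * g (k - i))"
proof -
  define x where "x i = (if i \<le> k then g (k - i) / g k else 0)" for i
  have x: "0 \<le> x i" "x i \<le> (1 / \<rho> (k - 1)) ^ i" "(1 / \<rho> (k - 1)) ^ i - x i \<le> 15 / k" if "i \<le> 6" for i
    using g_quotient_bounds[OF that k r] by (simp_all add: x_def)
  have eq: "(\<Sum>i=0..k. coeff W i * g (k - i)) = g k * (\<Sum>i\<le>6. coeff W i * x i)"
    unfolding x_def by (rule conv_poly_eq[OF W])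
  have "poly W (1 / \<rho> (k - 1)) - (\<Sum>i\<le>6. coeff W i * x i) = (\<Sum>i\<le>6. coeff W i * ((1 / \<rho> (k - 1)) ^ i - x i))"
    unfolding poly_eq_sum_atMost[OF W] by (simp add: sum_subtractf right_diff_distrib)
  also have "\<dots> \<le> (\<Sum>i\<le>6. \<bar>coeff W i\<bar> * (15 / k))"
  proof (intro sum_mono)
    fix i assume "i \<in> {..6 :: nat}"
    then have i: "i \<le> 6" by simp
    have "coeff W i * ((1 / \<rho> (k - 1)) ^ i - x i) \<le> \<bar>coeff W i\<bar> * ((1 / \<rho> (k - 1)) ^ i - x i)"
      using x[OF i] by (intro mult_right_mono) auto
    also have "\<dots> \<le> \<bar>coeff W i\<bar> * (15 / k)" using x[OF i] by (intro mult_left_mono) auto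
    finally show "coeff W i * ((1 / \<rho> (k - 1)) ^ i - x i) \<le> \<bar>coeff W i\<bar> * (15 / k)" .
  qed
  also have "\<dots> = 15 / k * M" unfolding M_def sum_distrib_right[symmetric] by (rule mult.commute)
  finally show "g k * (poly W (1 / \<rho> (k - 1)) - 15 / k * M) \<le> (\<Sum>i=0..k. coeff W i * g (k - i))"
    unfolding eq using g_pos[of k] by (intro mult_left_mono) auto
  have x0: "x 0 = 1" using g_pos[of k] by (simp add: x_def)
  have "coeff W 0 - (\<Sum>i\<le>6. coeff W i * x i) = (\<Sum>i\<in>{1..6}. - coeff W i * x i)"
  proof -
    have "{..6 :: nat} = insert 0 {1..6}" by auto
    then show ?thesis by (simp add: x0 sum_negf)
  qed
  also have "\<dots> \<le> (\<Sum>i\<in>{1..6}. \<bar>coeff W i\<bar> * (1 / \<rho> (k - 1)))"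
  proof (intro sum_mono)
    fix i assume i: "i \<in> {1..6 :: nat}"
    have "- coeff W i * x i \<le> \<bar>coeff W i\<bar> * x i" using x(1)[of i] i by (intro mult_right_mono) auto
    also have "x i \<le> (1 / \<rho> (k - 1)) ^ 1"
      using x(2)[of i] power_decreasing[of 1 i "1 / \<rho> (k - 1)"] i r by simp
    then have "\<bar>coeff W i\<bar> * x i \<le> \<bar>coeff W i\<bar> * (1 / \<rho> (k - 1))" by (intro mult_left_mono) auto
    finally show "- coeff W i * x i \<le> \<bar>coeff W i\<bar> * (1 / \<rho> (k - 1))" .
  qed
  also have "\<dots> \<le> (\<Sum>i\<le>6. \<bar>coeff W i\<bar> * (1 / \<rho> (k - 1)))"
    using r by (intro sum_mono2) auto
  also have "\<dots> = M / \<rho> (k - 1)" by (simp add: M_def sum_divide_distrib)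
  finally show "g k * (coeff W 0 - M / \<rho> (k - 1)) \<le> (\<Sum>i=0..k. coeff W i * g (k - i))"
    unfolding eq using g_pos[of k] by (intro mult_left_mono) auto
qed

section \<open>Explicit bounds for the ratios\<close>

lemma \<rho>_sq_lower:
  assumes "e \<le> E"
  shows "(m + real e) / (real e + 2) \<le> (\<rho> e)\<^sup>2"
proof -
  have "p * \<rho> e > 0" using p_pos \<rho>_pos by simp
  then have "m + real e \<le> (real e + 2) * (\<rho> e)\<^sup>2"
    using \<rho>_bounds[OF assms] by linarith
  then show ?thesis by (simp add: divide_le_eq mult.commute)
qed

lemma \<rho>_ge_1:
  assumes "e \<le> E"
  shows "\<rho> e \<ge> 1"
proof (rule power2_le_imp_le)
  have "1 \<le> (m + real e) / (real e + 2)" using m_ge by simp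
  then have "1 \<le> (\<rho> e)\<^sup>2" using \<rho>_sq_lower[OF assms] by linarith
  then show "1\<^sup>2 \<le> (\<rho> e)\<^sup>2" by simp
qed (simp add: less_imp_le[OF \<rho>_pos])

lemma \<rho>_upper:
  assumes "e \<le> E"
  defines "b \<equiv> p / (real e + 1)"
  shows "\<rho> e \<le> b / 2 + sqrt (b\<^sup>2 / 4 + (m + real e - 1) / (real e + 1))"
proof -
  have "(real e + 1) * (\<rho> e)\<^sup>2 \<le> p * \<rho> e + (m + real e - 1)"
    using \<rho>_bounds[OF assms(1)] by linarith
  then have "(\<rho> e)\<^sup>2 \<le> (p * \<rho> e + (m + real e - 1)) / (real e + 1)"
    by (simp add: pos_le_divide_eq mult.commute)
  also have "\<dots> = b * \<rho> e + (m + real e - 1) / (real e + 1)" by (simp add: b_def add_divide_distrib)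
  finally have "(\<rho> e - b / 2)\<^sup>2 \<le> b\<^sup>2 / 4 + (m + real e - 1) / (real e + 1)"
    by (simp add: power2_eq_square algebra_simps)
  then have "\<rho> e - b / 2 \<le> sqrt (b\<^sup>2 / 4 + (m + real e - 1) / (real e + 1))" by (rule real_le_rsqrt)
  then show ?thesis by simp
qed

end

section \<open>Coefficient extraction\<close>

abbreviation \<X> :: "real fps" where "\<X> \<equiv> fps_X"

lemma fps_nth_X_deriv: "fps_nth (\<X> * fps_deriv f) n = real n * fps_nth f n"
  by (cases n) auto

lemma mult_deriv_power:
  fixes f :: "real fps"
  shows "f * fps_deriv (f ^ n) = of_nat n * fps_deriv f * f ^ n"
  by (induction n) (auto simp: algebra_simps)

lemma mult_deriv_inverse_power:
  fixes f :: "real fps"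
  assumes "fps_nth f 0 \<noteq> 0"
  shows "f * fps_deriv (inverse f ^ n) = - (of_nat n * fps_deriv f * inverse f ^ n)"
proof -
  have "f * (inverse f * fps_deriv (inverse f ^ n))
      = f * (of_nat n * (- fps_deriv f * (inverse f)\<^sup>2) * inverse f ^ n)"
    unfolding mult_deriv_power using fps_inverse_deriv[OF assms] by simp
  moreover have "f * inverse f = 1"
    using assms by (simp add: inverse_mult_eq_1')
  ultimately show ?thesis
    by (simp add: power2_eq_square mult.assoc[symmetric])
qed

abbreviation \<A> :: "real fps" where "\<A> \<equiv> 1 - fps_X"
abbreviation \<B> :: "real fps" where "\<B> \<equiv> 1 + fps_X"

lemma one_minus_plus_X_inverse: "\<A> \<noteq> 0" "\<B> \<noteq> 0" "\<A> * inverse \<A> = 1" "\<B> * inverse \<B> = 1"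
  by (auto simp: fps_eq_iff inverse_mult_eq_1' intro!: exI[of _ 0])

lemma mult_inverse_power_cancel:
  fixes f :: "real fps"
  assumes "f * inverse f = 1"
  shows "inverse f ^ a * f ^ (a + b) = f ^ b" "inverse f ^ (a + b) * f ^ a = inverse f ^ b"
  using assms by (simp_all add: power_add power_mult_distrib[symmetric] mult_ac)

section \<open>The series Phi and its recurrence\<close>

definition \<Phi> :: "nat \<Rightarrow> nat \<Rightarrow> real fps" where
  "\<Phi> N Q = inverse \<A> ^ N * inverse \<B> ^ Q"

lemma \<Phi>_deriv: "\<A> * \<B> * fps_deriv (\<Phi> N Q) = (of_nat N * \<B> - of_nat Q * \<A>) * \<Phi> N Q"
proof -
  have "\<A> * \<B> * fps_deriv (\<Phi> N Q) = \<B> * inverse \<B> ^ Q * (\<A> * fps_deriv (inverse \<A> ^ N))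
      + \<A> * inverse \<A> ^ N * (\<B> * fps_deriv (inverse \<B> ^ Q))"
    by (simp add: \<Phi>_def algebra_simps)
  also have "\<dots> = (of_nat N * \<B> - of_nat Q * \<A>) * \<Phi> N Q"
    by (subst (1 2) mult_deriv_inverse_power) (simp_all add: \<Phi>_def algebra_simps)
  finally show ?thesis .
qed

lemma \<Phi>_rec:
  "(real e + 2) * fps_nth (\<Phi> N Q) (e + 2)
     = (real N - real Q) * fps_nth (\<Phi> N Q) (e + 1) + (real N + real Q + real e) * fps_nth (\<Phi> N Q) e"
proof -
  define f where "f = \<Phi> N Q"
  have 1: "\<A> * \<B> * fps_deriv f = fps_deriv f - \<X> * (\<X> * fps_deriv f)"
    by (simp add: algebra_simps)
  have 2: "(of_nat N * \<B> - of_nat Q * \<A>) * f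
      = fps_const (real N - real Q) * f + fps_const (real N + real Q) * (\<X> * f)"
    by (simp add: algebra_simps fps_of_nat fps_const_add[symmetric] fps_const_sub[symmetric] del: fps_const_add fps_const_sub)
  have "fps_nth (fps_deriv f - \<X> * (\<X> * fps_deriv f)) (e + 1)
      = fps_nth (fps_const (real N - real Q) * f + fps_const (real N + real Q) * (\<X> * f)) (e + 1)"
    using \<Phi>_deriv[of N Q] 1 2 by (simp add: f_def)
  then show ?thesis
    unfolding f_def[symmetric] fps_sub_nth fps_add_nth fps_mult_left_const_nth
    by (simp add: fps_nth_X_deriv algebra_simps del: fps_mult_fps_X_commute)
qed

lemma \<Phi>_0: "fps_nth (\<Phi> N Q) 0 = 1"
  by (simp add: \<Phi>_def fps_nth_power_0)

lemma \<Phi>_1: "fps_nth (\<Phi> N Q) 1 = real N - real Q"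
proof -
  have "fps_nth (\<A> * \<B> * fps_deriv (\<Phi> N Q)) 0 = fps_nth ((of_nat N * \<B> - of_nat Q * \<A>) * \<Phi> N Q) 0"
    by (simp only: \<Phi>_deriv)
  then show ?thesis by (simp add: \<Phi>_0)
qed

text \<open>Both extraction formulas are Lagrange inversion: the coefficient in question is a
  residue of the derivative of \<open>t\<^sup>-\<^sup>l\<close>, where \<open>t = u(1-u)\<^sup>2/(1+u)\<^sup>4\<close> for the code
  and \<open>t = y\<^sup>4/(1-y\<^sup>4)\<^sup>2\<close> for the shadow.\<close>

lemma code_residue:
  assumes "l > 0"
  shows "fps_nth ((1 - 6 * \<X> + \<X>\<^sup>2) * (inverse \<A> ^ (2 * l + 1) * \<B> ^ (4 * l - 1))) l = 0"
proof -
  define K where "K = inverse \<A> ^ (2 * l + 1) * \<B> ^ (4 * l - 1)"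
  define E where "E = inverse \<A> ^ (2 * l) * \<B> ^ (4 * l)"
  have "4 * l = Suc (4 * l - 1)" using assms by simp
  then have "\<B> ^ (4 * l) = \<B> * \<B> ^ (4 * l - 1)" by (metis power_Suc)
  then have EK: "E = \<A> * \<B> * K"
  proof -
    have "\<A> * \<B> * K = (\<A> * inverse \<A>) * inverse \<A> ^ (2 * l) * (\<B> * \<B> ^ (4 * l - 1))"
      unfolding K_def by (simp only: power_add power_one_right mult_ac)
    then show ?thesis unfolding one_minus_plus_X_inverse(3) E_def \<open>\<B> ^ (4 * l) = _\<close> by simp
  qed
  have "\<A> * \<B> * fps_deriv E = \<B> * \<B> ^ (4 * l) * (\<A> * fps_deriv (inverse \<A> ^ (2 * l)))
      + \<A> * inverse \<A> ^ (2 * l) * (\<B> * fps_deriv (\<B> ^ (4 * l)))"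
    by (simp add: E_def algebra_simps)
  also have "\<dots> = (of_nat (2 * l) * \<B> + of_nat (4 * l) * \<A>) * E"
    unfolding mult_deriv_power by (subst mult_deriv_inverse_power) (simp_all add: E_def algebra_simps)
  finally have dE: "\<A> * \<B> * fps_deriv E = (of_nat (2 * l) * \<B> + of_nat (4 * l) * \<A>) * E" .
  \<comment> \<open>\<open>E\<close> is u^l t^(-l), so the bracket is u^(l+1) times the derivative
    of t^(-l). The polynomial 1 - 6u + u^2 appears because u t'/t = (1 - 6u + u^2) /
    ((1-u)(1+u)).\<close>
  have "\<A> * \<B> * (\<X> * fps_deriv E - of_nat l * E) = \<X> * (\<A> * \<B> * fps_deriv E) - of_nat l * (\<A> * \<B>) * E"
    by (simp add: algebra_simps)
  also have "\<dots> = - of_nat l * (1 - 6 * \<X> + \<X>\<^sup>2) * E"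
    unfolding dE by (simp add: algebra_simps power2_eq_square)
  also have "\<dots> = \<A> * \<B> * (- of_nat l * ((1 - 6 * \<X> + \<X>\<^sup>2) * K))"
    by (subst EK) (simp only: mult_ac)
  finally have "\<X> * fps_deriv E - of_nat l * E = - of_nat l * ((1 - 6 * \<X> + \<X>\<^sup>2) * K)"
    using one_minus_plus_X_inverse(1,2) by (simp only: mult_cancel_left mult_eq_0_iff simp_thms)
  \<comment> \<open>Coefficient \<open>l\<close> of the left side is
    \<open>l * E_l - l * E_l\<close>: a derivative has no residue.\<close>
  then have "fps_nth (\<X> * fps_deriv E - of_nat l * E) l = fps_nth (- of_nat l * ((1 - 6 * \<X> + \<X>\<^sup>2) * K)) l"
    by simp
  then have "real l * fps_nth ((1 - 6 * \<X> + \<X>\<^sup>2) * K) l = 0"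
    unfolding fps_sub_nth fps_nth_X_deriv
    by (simp add: fps_of_nat[symmetric] del: fps_of_nat)
  then show ?thesis using assms by (simp add: K_def)
qed

abbreviation \<D> :: "real fps" where "\<D> \<equiv> 1 - fps_X ^ 4"

lemma one_minus_X4_inverse: "\<D> \<noteq> 0" "\<D> * inverse \<D> = 1"
  by (auto simp: fps_eq_iff inverse_mult_eq_1' fps_X_power_nth intro!: exI[of _ 0])

lemma shadow_residue:
  assumes "l > 0"
  shows "fps_nth ((1 + \<X> ^ 4) * \<D> ^ (2 * l - 1)) (4 * l) = 0"
proof -
  define K where "K = \<D> ^ (2 * l - 1)"
  have "2 * l = Suc (2 * l - 1)" using assms by simp
  then have E: "\<D> ^ (2 * l) = \<D> * K" unfolding K_def by (metis power_Suc)
  have d: "fps_deriv \<D> = - 4 * \<X> ^ 3"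
    by (simp add: fps_deriv_power)
  define F where "F = \<D> ^ (2 * l)"
  have dF: "\<D> * fps_deriv F = of_nat (2 * l) * (- 4 * \<X> ^ 3) * F"
    unfolding F_def mult_deriv_power d ..
  \<comment> \<open>The same computation with \<open>F\<close> = y^(4l) t^(-l), where now y t'/t = 4
    (1 + y^4) / (1 - y^4).\<close>
  have "\<D> * (\<X> * fps_deriv F - of_nat (4 * l) * F) = \<X> * (\<D> * fps_deriv F) - of_nat (4 * l) * \<D> * F"
    by (simp only: algebra_simps)
  also have "\<dots> = - of_nat (4 * l) * (1 + \<X> ^ 4) * F"
    unfolding dF by (simp add: algebra_simps power_numeral_reduce)
  also have "\<dots> = \<D> * (- of_nat (4 * l) * ((1 + \<X> ^ 4) * K))"
    unfolding F_def E by (simp only: mult_ac)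
  finally have "\<X> * fps_deriv F - of_nat (4 * l) * F
      = - of_nat (4 * l) * ((1 + \<X> ^ 4) * K)"
    using one_minus_X4_inverse by (simp only: mult_cancel_left) simp
  then have "fps_nth (\<X> * fps_deriv F - of_nat (4 * l) * F) (4 * l)
      = fps_nth (- of_nat (4 * l) * ((1 + \<X> ^ 4) * K)) (4 * l)" by simp
  then have "real (4 * l) * fps_nth ((1 + \<X> ^ 4) * K) (4 * l) = 0"
    unfolding fps_sub_nth fps_nth_X_deriv
    by (simp add: fps_of_nat[symmetric] del: fps_of_nat of_nat_mult)
  then show ?thesis using assms by (simp add: K_def)
qed

section \<open>Basis functions of code and shadow, and extraction of their coefficients\<close>

definition code_term :: "nat \<Rightarrow> nat \<Rightarrow> real fps" where
  "code_term h j = \<B> ^ (h - 4 * j) * (\<X> * \<A>\<^sup>2) ^ j"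

text \<open>With the respective t, \<open>code_term\<close> is (1+u)^h t^j and this is y^h t^(-j).
  As the powers run in opposite directions, the residue lemma handles \<open>j < J\<close> for the
  code but \<open>j > J\<close> for the shadow; the remaining terms start beyond the extracted
  index.\<close>

definition shadow_term :: "nat \<Rightarrow> nat \<Rightarrow> real fps" where
  "shadow_term h j = \<X> ^ (h - 4 * j) * \<D> ^ (2 * j)"

lemma code_extract:
  assumes "4 * J \<le> h" "4 * j \<le> h"
  shows "fps_nth ((1 - 6 * \<X> + \<X>\<^sup>2) * \<Phi> (2 * J + 1) (h + 1 - 4 * J) * code_term h j) J
       = (if j = J then 1 else 0)"
proof -
  define T where "T = (1 - 6 * \<X> + \<X>\<^sup>2) * \<Phi> (2 * J + 1) (h + 1 - 4 * J) * code_term h j"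
  define R where "R = (1 - 6 * \<X> + \<X>\<^sup>2) * \<Phi> (2 * J + 1) (h + 1 - 4 * J) * \<B> ^ (h - 4 * j) * \<A> ^ (2 * j)"
  have TR: "T = \<X> ^ j * R"
    unfolding T_def R_def code_term_def power_mult_distrib power_mult by (simp only: mult_ac)
  have nth: "fps_nth T J = (if J < j then 0 else fps_nth R (J - j))"
    unfolding TR by (simp add: fps_X_power_mult_nth)
  consider "J < j" | "j = J" | l where "l > 0" "J = j + l"
    by (metis less_imp_add_positive linorder_neqE_nat)
  then have "fps_nth T J = (if j = J then 1 else 0)"
  proof cases
    case 1
    then show ?thesis using nth by simp
  next
    case 2
    then have "fps_nth R (J - j) = 1"
      by (simp add: R_def \<Phi>_0 fps_nth_power_0 power2_eq_square)
    then show ?thesis using nth 2 by simp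
  next
    case 3
    have e1: "2 * J + 1 = (2 * l + 1) + 2 * j" using 3 by simp
    have e2: "h - 4 * j = (h + 1 - 4 * J) + (4 * l - 1)" using 3 assms by simp
    have "R = (1 - 6 * \<X> + \<X>\<^sup>2) * (inverse \<A> ^ (2 * J + 1) * \<A> ^ (2 * j))
        * (inverse \<B> ^ (h + 1 - 4 * J) * \<B> ^ (h - 4 * j))"
      unfolding R_def \<Phi>_def by (simp only: mult_ac)
    also have "inverse \<A> ^ (2 * J + 1) * \<A> ^ (2 * j) = inverse \<A> ^ (2 * l + 1)"
      unfolding e1 using mult_inverse_power_cancel(2)[OF one_minus_plus_X_inverse(3), of "2 * j" "2 * l + 1"] by (simp only: add.commute)
    also have "inverse \<B> ^ (h + 1 - 4 * J) * \<B> ^ (h - 4 * j) = \<B> ^ (4 * l - 1)"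
      unfolding e2 by (rule mult_inverse_power_cancel(1)[OF one_minus_plus_X_inverse(4)])
    finally have "R = (1 - 6 * \<X> + \<X>\<^sup>2) * (inverse \<A> ^ (2 * l + 1) * \<B> ^ (4 * l - 1))"
      by (simp only: mult_ac)
    then have "fps_nth R l = 0" using code_residue[OF 3(1)] by simp
    then show ?thesis using nth 3 by simp
  qed
  then show ?thesis by (simp add: T_def)
qed

lemma shadow_extract:
  assumes "4 * J \<le> h" "4 * j \<le> h"
  shows "fps_nth ((1 + \<X> ^ 4) * inverse \<D> ^ (2 * J + 1) * shadow_term h j) (h - 4 * J)
       = (if j = J then 1 else 0)"
proof -
  define R where "R = (1 + \<X> ^ 4) * inverse \<D> ^ (2 * J + 1) * \<D> ^ (2 * j)"
  have TR: "(1 + \<X> ^ 4) * inverse \<D> ^ (2 * J + 1) * shadow_term h j = \<X> ^ (h - 4 * j) * R"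
    unfolding shadow_term_def R_def by (simp only: mult_ac)
  have nth: "fps_nth ((1 + \<X> ^ 4) * inverse \<D> ^ (2 * J + 1) * shadow_term h j) (h - 4 * J)
      = (if h - 4 * J < h - 4 * j then 0 else fps_nth R (h - 4 * J - (h - 4 * j)))"
    unfolding TR fps_X_power_mult_nth ..
  consider "j < J" | "j = J" | l where "l > 0" "j = J + l"
    by (metis less_imp_add_positive linorder_neqE_nat)
  then show ?thesis
  proof cases
    case 1
    then show ?thesis using nth assms by simp
  next
    case 2
    then have "fps_nth R 0 = 1"
      by (simp add: R_def fps_nth_power_0 fps_X_power_nth)
    then show ?thesis using nth 2 by simp
  next
    case 3
    have e: "2 * j = (2 * J + 1) + (2 * l - 1)" using 3 by simp
    have "R = (1 + \<X> ^ 4) * (inverse \<D> ^ (2 * J + 1) * \<D> ^ (2 * j))"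
      unfolding R_def by (simp only: mult_ac)
    also have "inverse \<D> ^ (2 * J + 1) * \<D> ^ (2 * j) = \<D> ^ (2 * l - 1)"
      unfolding e by (rule mult_inverse_power_cancel(1)[OF one_minus_X4_inverse(2)])
    finally have "fps_nth R (4 * l) = 0" using shadow_residue[OF 3(1)] by simp
    moreover have "h - 4 * J - (h - 4 * j) = 4 * l" using 3 assms by simp
    ultimately show ?thesis using nth 3 assms by simp
  qed
qed

section \<open>Signs of the Gleason coefficients and the linear functional\<close>

lemma nonneg_coeffs_mult:
  fixes f k :: "real fps"
  assumes "\<And>i. fps_nth f i \<ge> 0" "\<And>i. fps_nth k i \<ge> 0"
  shows "fps_nth (f * k) n \<ge> 0"
  unfolding fps_mult_nth using assms by (intro sum_nonneg mult_nonneg_nonneg) auto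

lemma nonneg_coeffs_inverse_one_minus_X4: "fps_nth (inverse \<D> ^ a) n \<ge> 0"
proof -
  have eq: "inverse \<D> = 1 + \<X> ^ 4 * inverse \<D>"
    using one_minus_X4_inverse(2) by (simp add: algebra_simps)
  have "fps_nth (inverse \<D>) n \<ge> 0" for n
  proof (induction n rule: less_induct)
    case (less n)
    have "fps_nth (inverse \<D>) n = (if n = 0 then 1 else 0) + (if n < 4 then 0 else fps_nth (inverse \<D>) (n - 4))"
      by (subst eq) (simp add: fps_X_power_mult_nth)
    then show ?case using less[of "n - 4"] by auto
  qed
  then show ?thesis
    by (induction a arbitrary: n) (auto intro!: nonneg_coeffs_mult)
qed

text \<open>The kernel that extracts \<open>b J\<close> is \<open>1 + \<X> ^ 4\<close> times a power
  of the geometric series in y^4. Its coefficients are nonnegative, so \<open>b J\<close> is a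
  nonnegative combination of shadow coefficients.\<close>

lemma shadow_sign:
  assumes "\<And>i. fps_nth (\<Sum>j\<le>h div 4. fps_const (b j) * shadow_term h j) i \<ge> 0" "4 * J \<le> h"
  shows "b J \<ge> 0"
proof -
  define K where "K = (1 + \<X> ^ 4) * inverse \<D> ^ (2 * J + 1)"
  have K: "fps_nth K i \<ge> 0" for i
    unfolding K_def by (intro nonneg_coeffs_mult nonneg_coeffs_inverse_one_minus_X4) (simp add: fps_X_power_nth)
  have "0 \<le> fps_nth (K * (\<Sum>j\<le>h div 4. fps_const (b j) * shadow_term h j)) (h - 4 * J)"
    by (intro nonneg_coeffs_mult assms K)
  also have "K * (\<Sum>j\<le>h div 4. fps_const (b j) * shadow_term h j)
      = (\<Sum>j\<le>h div 4. fps_const (b j) * (K * shadow_term h j))"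
    by (simp only: sum_distrib_left mult_ac)
  also have "fps_nth \<dots> (h - 4 * J) = (\<Sum>j\<le>h div 4. b j * (if j = J then 1 else 0))"
    unfolding fps_sum_nth fps_mult_left_const_nth K_def
    by (intro sum.cong refl) (subst shadow_extract, use assms(2) in auto)
  also have "\<dots> = b J" using assms(2) by (simp add: if_distrib cong: if_cong)
  finally show ?thesis .
qed

lemma code_coefficient:
  assumes "4 * J \<le> h"
  shows "fps_nth ((1 - 6 * \<X> + \<X>\<^sup>2) * \<Phi> (2 * J + 1) (h + 1 - 4 * J) * (\<Sum>j\<le>h div 4. fps_const (a j) * code_term h j)) J = a J"
proof -
  define K where "K = (1 - 6 * \<X> + \<X>\<^sup>2) * \<Phi> (2 * J + 1) (h + 1 - 4 * J)"
  have "K * (\<Sum>j\<le>h div 4. fps_const (a j) * code_term h j)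
      = (\<Sum>j\<le>h div 4. fps_const (a j) * (K * code_term h j))"
    by (simp only: sum_distrib_left mult_ac)
  also have "fps_nth \<dots> J = (\<Sum>j\<le>h div 4. a j * (if j = J then 1 else 0))"
    unfolding fps_sum_nth fps_mult_left_const_nth K_def
    by (intro sum.cong refl) (subst code_extract, use assms in auto)
  also have "\<dots> = a J" using assms by (simp add: if_distrib cong: if_cong)
  finally show ?thesis by (simp add: K_def)
qed

definition \<Omega> :: "real \<Rightarrow> real fps" where
  "\<Omega> c = (1 - 6 * \<X> + \<X>\<^sup>2) * (\<B> ^ 4 - fps_const c * (\<X> * \<A>\<^sup>2))"

lemma \<Phi>_absorb:
  "\<A> ^ a * \<Phi> (N + a) Q = \<Phi> N Q" "\<B> ^ a * \<Phi> N (Q + a) = \<Phi> N Q"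
proof -
  have "\<A> ^ a * \<Phi> (N + a) Q = (inverse \<A> ^ (N + a) * \<A> ^ a) * inverse \<B> ^ Q"
    unfolding \<Phi>_def by (simp only: mult_ac)
  also have "inverse \<A> ^ (N + a) * \<A> ^ a = inverse \<A> ^ N"
    using mult_inverse_power_cancel(2)[OF one_minus_plus_X_inverse(3), of a N] by (simp only: add.commute)
  finally show "\<A> ^ a * \<Phi> (N + a) Q = \<Phi> N Q" by (simp only: \<Phi>_def)
  have "\<B> ^ a * \<Phi> N (Q + a) = inverse \<A> ^ N * (inverse \<B> ^ (Q + a) * \<B> ^ a)"
    unfolding \<Phi>_def by (simp only: mult_ac)
  also have "inverse \<B> ^ (Q + a) * \<B> ^ a = inverse \<B> ^ Q"
    using mult_inverse_power_cancel(2)[OF one_minus_plus_X_inverse(4), of a Q] by (simp only: add.commute)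
  finally show "\<B> ^ a * \<Phi> N (Q + a) = \<Phi> N Q" by (simp only: \<Phi>_def)
qed

text \<open>The kernels extracting \<open>a (J + 1)\<close> and \<open>a J\<close> are
  \<open>\<B> ^ 4\<close> and \<open>\<A>\<^sup>2\<close> times the common factor
  \<open>\<Phi> (2 * J + 3) (h + 1 - 4 * J)\<close>, up to the shared quadratic. The extra
  \<open>\<X>\<close> inside \<open>\<Omega>\<close> moves the extraction index from
  \<open>J\<close> to \<open>J + 1\<close>, so one coefficient yields both.\<close>

lemma code_functional:
  assumes h: "4 * (J + 1) \<le> h"
    and V: "V = (\<Sum>j\<le>h div 4. fps_const (a j) * code_term h j)"
  shows "fps_nth (\<Omega> c * \<Phi> (2 * J + 3) (h + 1 - 4 * J) * V) (J + 1) = a (J + 1) - c * a J"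
proof -
  define P where "P = \<Phi> (2 * J + 3) (h + 1 - 4 * J)"
  have 1: "\<A>\<^sup>2 * P = \<Phi> (2 * J + 1) (h + 1 - 4 * J)"
    using \<Phi>_absorb(1)[of 2 "2 * J + 1"] by (simp add: P_def numeral_3_eq_3)
  have 2: "\<B> ^ 4 * P = \<Phi> (2 * (J + 1) + 1) (h + 1 - 4 * (J + 1))"
    using \<Phi>_absorb(2)[of 4 "2 * J + 3" "h + 1 - 4 * (J + 1)"] h by (simp add: P_def numeral_3_eq_3)
  define W1 where "W1 = (1 - 6 * \<X> + \<X>\<^sup>2) * (\<B> ^ 4 * P) * V"
  define W0 where "W0 = (1 - 6 * \<X> + \<X>\<^sup>2) * (\<A>\<^sup>2 * P) * V"
  have "fps_nth W1 (J + 1) = a (J + 1)"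
    unfolding W1_def 2 V by (rule code_coefficient[OF h])
  moreover have "fps_nth W0 J = a J"
    unfolding W0_def 1 V by (rule code_coefficient) (use h in simp)
  moreover have "\<Omega> c * P * V = W1 - fps_const c * (\<X> * W0)"
    unfolding \<Omega>_def W1_def W0_def by (simp only: algebra_simps)
  ultimately have "fps_nth (\<Omega> c * P * V) (J + 1) = a (J + 1) - c * a J"
    by (simp del: fps_mult_fps_X_commute)
  then show ?thesis by (simp add: P_def)
qed

lemma code_functional_nonpos:
  assumes h: "4 * (J + 1) \<le> h" and J: "even J" and c: "c \<ge> 0"
    and V: "V = (\<Sum>j\<le>h div 4. fps_const (a j) * code_term h j)"
    and S: "\<And>i. fps_nth (\<Sum>j\<le>h div 4. fps_const ((-1) ^ j * a j * d j) * shadow_term h j) i \<ge> 0"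
    and d: "\<And>j. d j > 0"
  shows "fps_nth (\<Omega> c * \<Phi> (2 * J + 3) (h + 1 - 4 * J) * V) (J + 1) \<le> 0"
proof -
  have "(-1) ^ J * a J * d J \<ge> 0" using shadow_sign[OF S, of J] h by simp
  then have "a J \<ge> 0" using J d[of J] by (simp add: zero_le_mult_iff)
  have "(-1) ^ (J + 1) * a (J + 1) * d (J + 1) \<ge> 0" using shadow_sign[OF S, of "J + 1"] h by simp
  then have "a (J + 1) \<le> 0" using J d[of "J + 1"] by (simp add: mult_le_0_iff)
  then show ?thesis
    unfolding code_functional[OF h V] using mult_nonneg_nonneg[OF c \<open>a J \<ge> 0\<close>] by linarith
qed

section \<open>Self-dual families of sets\<close>

lemma card_sym_diff_add:
  assumes "finite Y" "finite Z"
  shows "card (sym_diff Y Z) + 2 * card (Y \<inter> Z) = card Y + card Z"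
proof -
  have "card Y = card (Y - Z) + card (Y \<inter> Z)" "card Z = card (Z - Y) + card (Y \<inter> Z)"
    using assms by (metis card_Diff_subset_Int card_mono finite_Int inf_le1 le_add_diff_inverse2 Int_commute)+
  moreover have "card (sym_diff Y Z) = card (Y - Z) + card (Z - Y)"
    using assms by (intro card_Un_disjoint) auto
  ultimately show ?thesis by simp
qed

lemma even_card_sym_diff:
  assumes "finite Y" "finite Z"
  shows "even (card (sym_diff Y Z)) \<longleftrightarrow> (even (card Y) \<longleftrightarrow> even (card Z))"
  using card_sym_diff_add[OF assms] by (metis even_add even_mult_iff even_numeral)

text \<open>The sum expands a product over the points of \<open>N\<close>, with factor
  \<open>1 - x\<close> on \<open>Y\<close> and \<open>1 + x\<close> off it.\<close>

lemma sum_Pow_sign_power: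
  fixes x :: real
  assumes "finite N" "Y \<subseteq> N"
  shows "(\<Sum>X\<in>Pow N. (-1) ^ card (X \<inter> Y) * x ^ card X) = (1 - x) ^ card Y * (1 + x) ^ (card N - card Y)"
proof -
  define f where "f i = (if i \<in> Y then - 1 else 1) * x" for i
  have f: "(\<Prod>i\<in>X. f i) = (-1) ^ card (X \<inter> Y) * x ^ card X" if "X \<in> Pow N" for X
  proof -
    have "finite X" using that assms finite_subset by auto
    then have "(\<Prod>i\<in>X. if i \<in> Y then - 1 else (1::real)) = (-1) ^ card (X \<inter> Y)"
      by (subst prod.If_cases) (auto simp: Int_def)
    then show ?thesis by (simp add: f_def prod.distrib)
  qed
  have "(\<Prod>i\<in>N. f i + 1) = (\<Sum>X\<in>Pow N. (-1) ^ card (X \<inter> Y) * x ^ card X)"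
    unfolding prod_add[OF assms(1)] by (intro sum.cong refl) (simp add: f)
  moreover have "(\<Prod>i\<in>N. f i + 1) = (\<Prod>i\<in>N. if i \<in> Y then 1 - x else 1 + x)"
    by (intro prod.cong refl) (auto simp: f_def)
  moreover have "\<dots> = (1 - x) ^ card Y * (1 + x) ^ (card N - card Y)"
  proof -
    have "N \<inter> {i. i \<in> Y} = Y" "N \<inter> - {i. i \<in> Y} = N - Y" using assms by auto
    then show ?thesis
      using assms by (subst prod.If_cases) (auto simp: card_Diff_subset finite_subset)
  qed
  ultimately show ?thesis by simp
qed

text \<open>Words are replaced by their supports: symmetric difference is addition, and the parity
  of an intersection is the inner product. Closure under addition (\<open>sym_diff_C\<close>)
  follows from the fixed-point equation.\<close>

locale self_dual_sets =
  fixes n :: nat and C :: "nat set set"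
  assumes self_dual: "C = {Y. Y \<subseteq> {..<n} \<and> (\<forall>Z\<in>C. even (card (Y \<inter> Z)))}"
begin

lemma C_subset: "Y \<in> C \<Longrightarrow> Y \<subseteq> {..<n}"
  and C_even_Int: "Y \<in> C \<Longrightarrow> Z \<in> C \<Longrightarrow> even (card (Y \<inter> Z))"
  and C_memI: "Y \<subseteq> {..<n} \<Longrightarrow> (\<And>Z. Z \<in> C \<Longrightarrow> even (card (Y \<inter> Z))) \<Longrightarrow> Y \<in> C"
  using self_dual by blast+

lemma C_finite [simp]: "Y \<in> C \<Longrightarrow> finite Y"
  using C_subset finite_subset by blast

lemma C_card_le: "Y \<in> C \<Longrightarrow> card Y \<le> n"
  using card_mono[OF finite_lessThan C_subset] by simp

lemma finite_C [simp]: "finite C"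
  by (rule finite_subset[of _ "Pow {..<n}"]) (auto dest: C_subset)

lemma C_even: "Y \<in> C \<Longrightarrow> even (card Y)"
  using C_even_Int[of Y Y] by simp

lemma empty_C: "{} \<in> C"
  by (rule C_memI) auto

lemma full_C: "{..<n} \<in> C"
  by (rule C_memI) (use C_subset C_even in \<open>auto simp: inf.absorb2\<close>)

lemma sym_diff_C:
  assumes "Y \<in> C" "Z \<in> C"
  shows "sym_diff Y Z \<in> C"
proof (rule C_memI)
  show "sym_diff Y Z \<subseteq> {..<n}" using assms C_subset by blast
  fix U assume U: "U \<in> C"
  have "sym_diff Y Z \<inter> U = sym_diff (Y \<inter> U) (Z \<inter> U)" by blast
  then show "even (card (sym_diff Y Z \<inter> U))"
    using even_card_sym_diff[of "Y \<inter> U" "Z \<inter> U"] assms U C_even_Int by simp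
qed

lemma bij_betw_sym_diff:
  assumes "Z \<in> C"
  shows "bij_betw (\<lambda>Y. sym_diff Y Z) C C"
  by (rule bij_betwI[where g = "\<lambda>Y. sym_diff Y Z"]) (use sym_diff_C[OF _ assms] in auto)

text \<open>Translation by some \<open>Z\<close> with \<open>f Z = -1\<close> permutes
  \<open>C\<close> and negates the sum.\<close>

lemma character_sum:
  fixes f :: "nat set \<Rightarrow> real"
  assumes mult: "\<And>Y Z. Y \<in> C \<Longrightarrow> Z \<in> C \<Longrightarrow> f (sym_diff Y Z) = f Y * f Z"
    and sign: "\<And>Y. Y \<in> C \<Longrightarrow> f Y = 1 \<or> f Y = -1"
  shows "sum f C = (if \<forall>Y\<in>C. f Y = 1 then real (card C) else 0)"
proof (cases "\<forall>Y\<in>C. f Y = 1")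
  case False
  then obtain Z where Z: "Z \<in> C" "f Z = -1" using sign by blast
  have "sum f C = (\<Sum>Y\<in>C. f (sym_diff Y Z))"
    by (rule sum.reindex_bij_betw[OF bij_betw_sym_diff[OF Z(1)], symmetric])
  also have "\<dots> = - sum f C" using Z mult by (simp add: sum_negf)
  finally show ?thesis using False by (simp only: if_False)
qed auto

lemma minus_one_power_eq_iff: "(-1 :: real) ^ k = 1 \<longleftrightarrow> even k"
  by (cases "even k") auto

lemma dual_character_sum:
  assumes "X \<subseteq> {..<n}"
  shows "(\<Sum>Y\<in>C. (-1) ^ card (X \<inter> Y)) = (if X \<in> C then real (card C) else 0)"
proof -
  have "(-1 :: real) ^ card (X \<inter> sym_diff Y Z) = (-1) ^ card (X \<inter> Y) * (-1) ^ card (X \<inter> Z)"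
    if "Y \<in> C" "Z \<in> C" for Y Z
  proof -
    have "X \<inter> sym_diff Y Z = sym_diff (X \<inter> Y) (X \<inter> Z)" by blast
    then show ?thesis
      using even_card_sym_diff[of "X \<inter> Y" "X \<inter> Z"] that by (auto simp: minus_one_power_iff)
  qed
  then have "(\<Sum>Y\<in>C. (-1 :: real) ^ card (X \<inter> Y))
      = (if \<forall>Y\<in>C. (-1 :: real) ^ card (X \<inter> Y) = 1 then real (card C) else 0)"
    by (intro character_sum) (auto simp: minus_one_power_iff)
  moreover have "(\<forall>Y\<in>C. (-1 :: real) ^ card (X \<inter> Y) = 1) \<longleftrightarrow> X \<in> C"
    unfolding minus_one_power_eq_iff using assms C_memI C_even_Int by blast
  ultimately show ?thesis by simp
qed

lemma MacWilliams_card: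
  "(\<Sum>Y\<in>C. (1 - x) ^ card Y * (1 + x) ^ (n - card Y)) = real (card C) * (\<Sum>Y\<in>C. (x :: real) ^ card Y)"
proof -
  have "(\<Sum>Y\<in>C. (1 - x) ^ card Y * (1 + x) ^ (n - card Y))
      = (\<Sum>Y\<in>C. \<Sum>X\<in>Pow {..<n}. (-1) ^ card (X \<inter> Y) * x ^ card X)"
    using C_subset by (intro sum.cong refl) (subst sum_Pow_sign_power, auto)
  also have "\<dots> = (\<Sum>X\<in>Pow {..<n}. (\<Sum>Y\<in>C. (-1) ^ card (X \<inter> Y)) * x ^ card X)"
    unfolding sum_distrib_right by (rule sum.swap)
  also have "\<dots> = (\<Sum>X\<in>Pow {..<n}. if X \<in> C then real (card C) * x ^ card X else 0)"
    by (intro sum.cong refl) (simp add: dual_character_sum)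
  also have "\<dots> = (\<Sum>X\<in>C. real (card C) * x ^ card X)"
    using C_subset by (intro sum.mono_neutral_cong_right) auto
  finally show ?thesis by (simp add: sum_distrib_left)
qed

text \<open>At \<open>x = 1\<close> every nonempty word contributes a factor 0 on the left of the
  MacWilliams identity, so only the empty set survives. This takes the place of a dimension
  count.\<close>

lemma card_C_sq: "card C ^ 2 = 2 ^ n"
proof -
  have "(\<Sum>Y\<in>C. (1 - 1 :: real) ^ card Y * (1 + 1) ^ (n - card Y)) = (\<Sum>Y\<in>C. if Y = {} then 2 ^ n else 0)"
    by (intro sum.cong refl) (auto simp: zero_power card_gt_0_iff)
  also have "\<dots> = 2 ^ n" using empty_C by simp
  finally have "real (card C) * real (card C) = 2 ^ n" using MacWilliams_card[of 1] by simp
  then have "real (card C ^ 2) = real (2 ^ n)" by (simp add: power2_eq_square)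
  then show ?thesis using of_nat_eq_iff by blast
qed

lemma n_even: "even n" and card_C: "card C = 2 ^ (n div 2)"
proof -
  have "card C dvd 2 ^ n" using card_C_sq by (metis dvd_triv_left power2_eq_square)
  then obtain k where k: "card C = 2 ^ k"
    using divides_primepow_nat[OF two_is_prime_nat] by blast
  then have "(2::nat) ^ (2 * k) = 2 ^ n" using card_C_sq by (simp add: power_mult power2_eq_square power_mult_distrib mult.commute flip: power_add)
  then have "2 * k = n" by simp
  then show "even n" "card C = 2 ^ (n div 2)" using k by auto
qed

section \<open>Weight enumerator, MacWilliams identity and shadow\<close>

definition h where "h = n div 2"

lemma n_eq: "n = 2 * h"
  using n_even by (simp add: h_def)

definition V :: "real poly" where "V = (\<Sum>Y\<in>C. monom 1 (card Y div 2))"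

lemma poly_V: "poly V u = (\<Sum>Y\<in>C. u ^ (card Y div 2))"
  by (simp add: V_def poly_sum poly_monom)

text \<open>One identity for two uses: \<open>s = 1\<close> gives MacWilliams and
  \<open>s = -1\<close> the shadow. Even weights make the enumerator a polynomial in the square of
  its argument.\<close>

lemma poly_V_transform:
  assumes "1 + y \<noteq> 0"
  shows "(1 + y) ^ n * poly V (s * ((1 - y) / (1 + y))\<^sup>2)
       = (\<Sum>Y\<in>C. s ^ (card Y div 2) * ((1 - y) ^ card Y * (1 + y) ^ (n - card Y)))"
  unfolding poly_V sum_distrib_left
proof (intro sum.cong refl)
  fix Y assume Y: "Y \<in> C"
  have "(((1 - y) / (1 + y))\<^sup>2) ^ (card Y div 2) = ((1 - y) / (1 + y)) ^ card Y"
    unfolding power_mult[symmetric] using C_even[OF Y] by simp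
  moreover have "(1 + y) ^ n = (1 + y) ^ card Y * (1 + y) ^ (n - card Y)"
    using C_card_le[OF Y] by (simp flip: power_add)
  moreover have "(1 + y) ^ card Y * ((1 - y) / (1 + y)) ^ card Y = (1 - y) ^ card Y"
    using assms by (simp flip: power_mult_distrib)
  moreover have "(b * t) * (s' * q) = s' * ((b * q) * t)" for b t s' q :: real
    by simp
  ultimately show "(1 + y) ^ n * (s * ((1 - y) / (1 + y))\<^sup>2) ^ (card Y div 2)
      = s ^ (card Y div 2) * ((1 - y) ^ card Y * (1 + y) ^ (n - card Y))"
    by (simp only: power_mult_distrib[of s])
qed

lemma V_MacWilliams:
  assumes "1 + y \<noteq> 0"
  shows "(1 + y) ^ (2 * h) * poly V (((1 - y) / (1 + y))\<^sup>2) = 2 ^ h * poly V (y\<^sup>2)"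
proof -
  have "(1 + y) ^ n * poly V (1 * ((1 - y) / (1 + y))\<^sup>2) = real (card C) * (\<Sum>Y\<in>C. y ^ card Y)"
    unfolding poly_V_transform[OF assms] using MacWilliams_card[of y] by simp
  also have "(\<Sum>Y\<in>C. y ^ card Y) = poly V (y\<^sup>2)"
    unfolding poly_V by (intro sum.cong refl) (simp add: C_even flip: power_mult)
  finally show ?thesis unfolding card_C by (simp flip: h_def n_eq)
qed

text \<open>The coefficients are the sums \<open>s X\<close> over \<open>C\<close> of a sign that
  combines half the weight of \<open>Y\<close> with its intersection with \<open>X\<close>.
  Intersections within \<open>C\<close> are even, so half the weight is additive modulo 2 and the
  sign is a character of \<open>C\<close>. Hence \<open>s X\<close> is 0 or
  \<open>card C\<close>.\<close>

lemma V_shadow: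
  obtains S :: "real poly" where "\<And>i. coeff S i \<ge> 0"
    "\<And>y. 1 + y \<noteq> 0 \<Longrightarrow> poly S y = (1 + y) ^ (2 * h) * poly V (- (((1 - y) / (1 + y))\<^sup>2))"
proof -
  define s where "s X = (\<Sum>Y\<in>C. (-1 :: real) ^ (card Y div 2) * (-1) ^ card (X \<inter> Y))" for X
  have s: "s X \<ge> 0" for X
  proof -
    have "(-1 :: real) ^ (card (sym_diff Y Z) div 2) * (-1) ^ card (X \<inter> sym_diff Y Z)
        = ((-1) ^ (card Y div 2) * (-1) ^ card (X \<inter> Y)) * ((-1) ^ (card Z div 2) * (-1) ^ card (X \<inter> Z))"
      if "Y \<in> C" "Z \<in> C" for Y Z
    proof -
      have "X \<inter> sym_diff Y Z = sym_diff (X \<inter> Y) (X \<inter> Z)" by blast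
      then have "(-1 :: real) ^ card (X \<inter> sym_diff Y Z) = (-1) ^ card (X \<inter> Y) * (-1) ^ card (X \<inter> Z)"
        using even_card_sym_diff[of "X \<inter> Y" "X \<inter> Z"] that by (auto simp: minus_one_power_iff)
      moreover have "(-1 :: real) ^ (card (sym_diff Y Z) div 2) = (-1) ^ (card Y div 2) * (-1) ^ (card Z div 2)"
      proof -
        have arith: "a + 2 * c = b + e \<Longrightarrow> even a \<Longrightarrow> even b \<Longrightarrow> even e \<Longrightarrow> a div 2 + c = b div 2 + e div 2"
          for a b c e :: nat by (elim evenE) simp
        have "card (sym_diff Y Z) div 2 + card (Y \<inter> Z) = card Y div 2 + card Z div 2"
          by (rule arith[OF card_sym_diff_add C_even[OF sym_diff_C] C_even C_even]) (use that in auto)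
        then have "(-1 :: real) ^ (card (sym_diff Y Z) div 2) * (-1) ^ card (Y \<inter> Z) = (-1) ^ (card Y div 2) * (-1) ^ (card Z div 2)"
          unfolding power_add[symmetric] by (rule arg_cong)
        moreover have "(-1 :: real) ^ card (Y \<inter> Z) = 1" using C_even_Int[OF that] by simp
        ultimately show ?thesis by (simp only: mult_1_right)
      qed
      ultimately show ?thesis by (simp only: mult_ac)
    qed
    then have "s X = (if \<forall>Y\<in>C. (-1 :: real) ^ (card Y div 2) * (-1) ^ card (X \<inter> Y) = 1 then real (card C) else 0)"
      unfolding s_def by (rule character_sum) (simp_all add: minus_one_power_iff)
    then show ?thesis by simp
  qed
  define S where "S = (\<Sum>X\<in>Pow {..<n}. monom (s X) (card X))"
  show ?thesis
  proof (rule that[of S])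
    show "coeff S i \<ge> 0" for i
      unfolding S_def coeff_sum using s by (intro sum_nonneg) auto
    fix y :: real assume y: "1 + y \<noteq> 0"
    have "(1 + y) ^ n * poly V ((-1) * ((1 - y) / (1 + y))\<^sup>2)
        = (\<Sum>Y\<in>C. (-1) ^ (card Y div 2) * (\<Sum>X\<in>Pow {..<n}. (-1) ^ card (X \<inter> Y) * y ^ card X))"
      unfolding poly_V_transform[OF y] using C_subset
      by (intro sum.cong refl) (subst sum_Pow_sign_power, auto)
    also have "\<dots> = (\<Sum>Y\<in>C. \<Sum>X\<in>Pow {..<n}. (-1) ^ (card Y div 2) * (-1) ^ card (X \<inter> Y) * y ^ card X)"
      by (simp add: sum_distrib_left mult_ac)
    also have "\<dots> = (\<Sum>X\<in>Pow {..<n}. s X * y ^ card X)"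
      unfolding s_def sum_distrib_right by (rule sum.swap)
    also have "\<dots> = poly S y" by (simp add: S_def poly_sum poly_monom)
    finally show "poly S y = (1 + y) ^ (2 * h) * poly V (- (((1 - y) / (1 + y))\<^sup>2))"
      using n_eq by simp
  qed
qed

lemma coeff_V: "coeff V i = real (card {Y \<in> C. card Y = 2 * i})"
proof -
  have "coeff V i = (\<Sum>Y\<in>C. if card Y = 2 * i then 1 else 0)"
    unfolding V_def coeff_sum
  proof (intro sum.cong refl)
    fix Y assume "Y \<in> C"
    then have "card Y div 2 = i \<longleftrightarrow> card Y = 2 * i" using C_even[of Y] by auto
    then show "coeff (monom (1 :: real) (card Y div 2)) i = (if card Y = 2 * i then 1 else 0)" by simp
  qed
  also have "\<dots> = real (card {Y \<in> C. card Y = 2 * i})"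
    by (subst sum.inter_filter[symmetric]) simp_all
  finally show ?thesis .
qed

lemma coeff_V_0: "coeff V 0 = 1"
proof -
  have "{Y \<in> C. card Y = 2 * 0} = {{}}" using empty_C by (auto simp: card_eq_0_iff)
  then show ?thesis unfolding coeff_V by simp
qed

text \<open>Complementation, that is, addition of the word \<open>full_C\<close>.\<close>

lemma coeff_V_reflect:
  assumes "i \<le> h"
  shows "coeff V (h - i) = coeff V i"
proof -
  have "bij_betw (\<lambda>Y. sym_diff Y {..<n}) {Y \<in> C. card Y = 2 * (h - i)} {Y \<in> C. card Y = 2 * i}"
  proof (rule bij_betwI[where g = "\<lambda>Y. sym_diff Y {..<n}"])
    have *: "sym_diff Y {..<n} \<in> C \<and> card (sym_diff Y {..<n}) = n - card Y" if "Y \<in> C" for Y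
    proof -
      have "sym_diff Y {..<n} = {..<n} - Y" using C_subset[OF that] by blast
      then show ?thesis using sym_diff_C[OF that full_C] C_subset[OF that] that
        by (simp add: card_Diff_subset)
    qed
    show "(\<lambda>Y. sym_diff Y {..<n}) \<in> {Y \<in> C. card Y = 2 * (h - i)} \<rightarrow> {Y \<in> C. card Y = 2 * i}"
      "(\<lambda>Y. sym_diff Y {..<n}) \<in> {Y \<in> C. card Y = 2 * i} \<rightarrow> {Y \<in> C. card Y = 2 * (h - i)}"
      using * assms n_eq by auto
  qed auto
  then show ?thesis unfolding coeff_V by (simp add: bij_betw_same_card)
qed

lemma degree_V: "degree V \<le> h"
proof (rule degree_le, intro allI impI)
  fix i assume "h < i"
  then have "{Y \<in> C. card Y = 2 * i} = {}" using C_card_le n_eq by force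
  then show "coeff V i = 0" unfolding coeff_V by simp
qed

end

section \<open>Gleason expansion of code and shadow\<close>

text \<open>Subtracting \<open>c * (1 + u) ^ h\<close>, with \<open>c\<close> the constant
  coefficient, removes both end coefficients. What is left is u times a polynomial that is
  palindromic for \<open>h - 2\<close>, and u = (1+u)^2 z with z = u/(1+u)^2 lets the induction
  continue.\<close>

lemma palindromic_poly_expansion:
  fixes P :: "real poly"
  assumes "degree P \<le> h" "\<And>i. i \<le> h \<Longrightarrow> coeff P (h - i) = coeff P i"
  shows "\<exists>Q. degree Q \<le> h div 2 \<and> (\<forall>u. 1 + u \<noteq> 0 \<longrightarrow> poly P u = (1 + u) ^ h * poly Q (u / (1 + u)\<^sup>2))"
  using assms
proof (induction h arbitrary: P rule: less_induct)
  case (less h)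
  define c where "c = coeff P 0"
  define R where "R = P - Polynomial.smult c ([:1, 1:] ^ h)"
  have cR: "coeff R i = coeff P i - c * real (h choose i)" for i
  proof (cases "i \<le> h")
    case True
    then show ?thesis by (simp add: R_def coeff_linear_poly_power)
  next
    case False
    then have "degree ([:1, 1 :: real:] ^ h) < i" using degree_power_le[of "[:1, 1 :: real:]" h] by simp
    then show ?thesis using False by (simp add: R_def coeff_eq_0 binomial_eq_0)
  qed
  have R: "poly P u = c * (1 + u) ^ h + poly R u" for u
    by (simp add: R_def)
  have dR: "coeff R i = 0" if "i \<ge> h" for i
  proof (cases "i = h")
    case True
    then show ?thesis using less.prems(2)[of 0] by (simp add: cR c_def)
  next
    case False
    then have "degree P < i" "h choose i = 0" using that less.prems(1) by (auto simp: binomial_eq_0)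
    then show ?thesis by (simp add: cR coeff_eq_0)
  qed
  have R0: "coeff R 0 = 0" by (simp add: cR c_def)
  show ?case
  proof (cases "h < 2")
    case True
    have "R = 0"
    proof (rule poly_eqI)
      show "coeff R i = coeff 0 i" for i
        using dR[of i] R0 True by (cases i) auto
    qed
    then show ?thesis using R by (intro exI[of _ "[:c:]"]) simp
  next
    case False
    obtain a P' where P': "R = pCons a P'" by (cases R)
    have cP': "coeff P' i = coeff R (Suc i)" for i by (simp add: P')
    have "\<exists>Q. degree Q \<le> (h - 2) div 2 \<and> (\<forall>u. 1 + u \<noteq> 0 \<longrightarrow> poly P' u = (1 + u) ^ (h - 2) * poly Q (u / (1 + u)\<^sup>2))"
    proof (rule less.IH)
      show "degree P' \<le> h - 2"
        by (rule degree_le) (use False dR in \<open>auto simp: cP'\<close>)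
      fix i assume i: "i \<le> h - 2"
      have "Suc (h - 2 - i) = h - Suc i" using i False by simp
      moreover have "h choose (h - Suc i) = h choose (Suc i)"
        using i False by (intro binomial_symmetric[symmetric]) auto
      ultimately show "coeff P' (h - 2 - i) = coeff P' i"
        using less.prems(2)[of "Suc i"] i False by (simp add: cP' cR)
    qed (use False in auto)
    then obtain Q where Q: "degree Q \<le> (h - 2) div 2"
      "\<And>u. 1 + u \<noteq> 0 \<Longrightarrow> poly P' u = (1 + u) ^ (h - 2) * poly Q (u / (1 + u)\<^sup>2)" by blast
    show ?thesis
    proof (intro exI[of _ "pCons c Q"] conjI allI impI)
      show "degree (pCons c Q) \<le> h div 2"
        using Q(1) False degree_pCons_le[of c Q] by linarith
      fix u :: real assume u: "1 + u \<noteq> 0"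
      have a: "a = 0" using R0 by (simp add: P')
      have "h = h - 2 + 2" using False by simp
      then have "(1 + u) ^ h = (1 + u) ^ (h - 2) * (1 + u)\<^sup>2" by (metis power_add)
      then show "poly P u = (1 + u) ^ h * poly (pCons c Q) (u / (1 + u)\<^sup>2)"
        using u by (simp add: R P' a Q(2) algebra_simps)
    qed
  qed
qed

text \<open>The polynomial z (1 - 4z) is invariant under z -> 1/4 - z and vanishes at 0 and 1/4. By
  symmetry \<open>Q\<close> minus its value at 0 also vanishes at both points, and dividing leaves
  an invariant polynomial of smaller degree.\<close>

lemma symmetric_poly_expansion:
  fixes Q :: "real poly"
  assumes "Q \<circ>\<^sub>p [:1/4, -1:] = Q"
  shows "\<exists>R. Q = R \<circ>\<^sub>p [:0, 1, -4:]"
  using assms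
proof (induction "degree Q" arbitrary: Q rule: less_induct)
  case less
  define c where "c = poly Q 0"
  define D where "D = [:0, 1, -4 :: real:]"
  have Dsym: "D \<circ>\<^sub>p [:1/4, -1:] = D" by (simp add: D_def pcompose_pCons algebra_simps)
  have "poly Q (1/4) = c" using arg_cong[OF less.prems, of "\<lambda>p. poly p 0"] by (simp add: poly_pcompose c_def)
  then have "[:- 1/4, 1:] dvd Q - [:c:]" "[:0, 1:] dvd Q - [:c:]"
    using poly_eq_0_iff_dvd[of "Q - [:c:]" "1/4"] poly_eq_0_iff_dvd[of "Q - [:c:]" 0] by (simp_all add: c_def)
  then obtain P1 where P1: "Q - [:c:] = [:0, 1:] * P1" by (elim dvdE)
  have "poly P1 (1/4) = 0"
    using arg_cong[OF P1, of "\<lambda>p. poly p (1/4)"] \<open>poly Q (1/4) = c\<close> by simp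
  then obtain P2 where P2: "P1 = [:- 1/4, 1:] * P2"
    using poly_eq_0_iff_dvd[of P1 "1/4"] by (auto elim: dvdE)
  define Q' where "Q' = Polynomial.smult (- 1/4) P2"
  have Q': "Q = [:c:] + D * Q'"
    using P1 by (simp add: P2 Q'_def D_def algebra_simps)
  show ?case
  proof (cases "Q' = 0")
    case True
    then show ?thesis using Q' by (intro exI[of _ "[:c:]"]) simp
  next
    case False
    have "D \<noteq> 0" by (simp add: D_def)
    have "D * (Q' \<circ>\<^sub>p [:1/4, -1:]) = D * Q'"
      using less.prems by (simp add: Q' pcompose_add pcompose_mult Dsym pcompose_const)
    then have "Q' \<circ>\<^sub>p [:1/4, -1:] = Q'" using \<open>D \<noteq> 0\<close> by simp
    moreover have "degree Q' < degree Q"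
    proof -
      have "degree (D * Q') = 2 + degree Q'" unfolding degree_mult_eq[OF \<open>D \<noteq> 0\<close> False] by (simp add: D_def)
      then show ?thesis unfolding Q' by (subst degree_add_eq_right) auto
    qed
    ultimately obtain R where "Q' = R \<circ>\<^sub>p [:0, 1, -4:]" using less.hyps by blast
    then show ?thesis using Q'
      by (intro exI[of _ "pCons c R"]) (simp add: pcompose_pCons D_def)
  qed
qed

context self_dual_sets
begin

text \<open>The reflection of the coefficients makes \<open>V\<close> a polynomial in z = u/(1+u)^2
  up to a power of 1+u. On z, with u = y^2, the MacWilliams substitution y -> (1-y)/(1+y) acts as z
  -> 1/4 - z, whose invariants are the polynomials in z (1 - 4z) = t.\<close>

lemma V_expansion:
  obtains a where "\<And>u. 1 + u \<noteq> 0 \<Longrightarrow>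
    poly V u = (\<Sum>j\<le>h div 4. a j * ((1 + u) ^ (h - 4 * j) * (u * (1 - u)\<^sup>2) ^ j))"
proof -
  obtain Q where dQ: "degree Q \<le> h div 2"
    and Q: "\<And>u. 1 + u \<noteq> 0 \<Longrightarrow> poly V u = (1 + u) ^ h * poly Q (u / (1 + u)\<^sup>2)"
    using palindromic_poly_expansion[OF degree_V coeff_V_reflect] by blast
  have sym: "poly Q (1/4 - z) = poly Q z" if "0 \<le> z" "z \<le> 1/4" for z
  proof -
    \<comment> \<open>Every z in [0, 1/4] comes from some y in [0, 1]; this gives the symmetry of
      \<open>Q\<close> at infinitely many points, hence identically.\<close>
    have "\<exists>y\<ge>0. y \<le> 1 \<and> y\<^sup>2 / (1 + y\<^sup>2)\<^sup>2 = z"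
    proof (rule IVT')
      show "continuous_on {0..1} (\<lambda>y :: real. y\<^sup>2 / (1 + y\<^sup>2)\<^sup>2)"
        by (intro continuous_intros) (auto simp: add_nonneg_eq_0_iff)
    qed (use that in auto)
    then obtain y where y: "y \<ge> 0" "z = y\<^sup>2 / (1 + y\<^sup>2)\<^sup>2" by blast
    define w where "w = (1 - y) / (1 + y)"
    have nz: "1 + y \<noteq> 0" "1 + y\<^sup>2 \<noteq> 0" "1 + w\<^sup>2 \<noteq> 0"
      using y(1) by (auto simp: add_nonneg_eq_0_iff)
    have w0: "(1 + y)\<^sup>2 * w\<^sup>2 = (1 - y)\<^sup>2" using nz(1) by (simp add: w_def power_divide)
    have w1: "(1 + y)\<^sup>2 * (1 + w\<^sup>2) = 2 * (1 + y\<^sup>2)"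
      unfolding distrib_left w0 by (simp add: power2_eq_square algebra_simps)
    have w2: "w\<^sup>2 / (1 + w\<^sup>2)\<^sup>2 = 1/4 - z"
    proof -
      have "w\<^sup>2 / (1 + w\<^sup>2)\<^sup>2 = ((1 + y)\<^sup>2 * (1 - y)\<^sup>2) / ((1 + y)\<^sup>2 * (1 + w\<^sup>2))\<^sup>2"
        using nz(1) by (simp add: power_mult_distrib flip: w0)
      also have "(1 + y)\<^sup>2 * (1 - y)\<^sup>2 = (1 + y\<^sup>2)\<^sup>2 - 4 * y\<^sup>2"
        by (simp add: algebra_simps power2_eq_square)
      also have "((1 + y\<^sup>2)\<^sup>2 - 4 * y\<^sup>2) / ((1 + y)\<^sup>2 * (1 + w\<^sup>2))\<^sup>2 = 1/4 - z"
      proof -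
        have "(N\<^sup>2 - 4 * Y) / (2 * N)\<^sup>2 = 1/4 - Y / N\<^sup>2" if "N \<noteq> 0" for N Y :: real
          using that by (simp add: field_simps power2_eq_square)
        then show ?thesis unfolding w1 y(2) using nz(2) .
      qed
      finally show ?thesis .
    qed
    have "(1 + y) ^ (2 * h) * poly V (w\<^sup>2) = 2 ^ h * poly V (y\<^sup>2)"
      using V_MacWilliams[OF nz(1)] by (simp add: w_def)
    moreover have "(1 + y) ^ (2 * h) * poly V (w\<^sup>2) = (2 * (1 + y\<^sup>2)) ^ h * poly Q (1/4 - z)"
      unfolding Q[OF nz(3)] w2 w1[symmetric] by (simp add: power_mult power_mult_distrib)
    moreover have "2 ^ h * poly V (y\<^sup>2) = (2 * (1 + y\<^sup>2)) ^ h * poly Q z"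
      unfolding Q[OF nz(2)] y(2) by (simp only: power_mult_distrib mult_ac)
    ultimately show ?thesis using nz(2) by simp
  qed
  have "Q \<circ>\<^sub>p [:1/4, -1:] = Q"
  proof (rule ccontr)
    assume "Q \<circ>\<^sub>p [:1/4, -1:] \<noteq> Q"
    then have "finite {z. poly (Q \<circ>\<^sub>p [:1/4, -1:] - Q) z = 0}"
      by (intro poly_roots_finite) simp
    moreover have "{0..1/4} \<subseteq> {z. poly (Q \<circ>\<^sub>p [:1/4, -1:] - Q) z = 0}"
      using sym by (auto simp: poly_pcompose)
    ultimately have "finite {0..1/4 :: real}" by (rule finite_subset[rotated])
    then show False using infinite_Icc[of 0 "1/4 :: real"] by simp
  qed
  then obtain R where R: "Q = R \<circ>\<^sub>p [:0, 1, -4:]" using symmetric_poly_expansion by blast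
  have dR: "degree R \<le> h div 4"
    using dQ by (simp add: R degree_pcompose)
  show ?thesis
  proof (rule that[of "coeff R"])
    fix u :: real assume u: "1 + u \<noteq> 0"
    have z: "u / (1 + u)\<^sup>2 * (1 - 4 * (u / (1 + u)\<^sup>2)) = u * (1 - u)\<^sup>2 / (1 + u) ^ 4"
      using u by (simp add: field_simps) (simp add: power2_eq_square power_numeral_reduce algebra_simps)
    have "poly V u = (1 + u) ^ h * poly R (u * (1 - u)\<^sup>2 / (1 + u) ^ 4)"
      unfolding Q[OF u] R poly_pcompose by (simp flip: z add: algebra_simps)
    also have "poly R (u * (1 - u)\<^sup>2 / (1 + u) ^ 4) = (\<Sum>j\<le>h div 4. coeff R j * (u * (1 - u)\<^sup>2 / (1 + u) ^ 4) ^ j)"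
      using dR by (rule poly_eq_sum_atMost)
    also have "(1 + u) ^ h * \<dots> = (\<Sum>j\<le>h div 4. coeff R j * ((1 + u) ^ (h - 4 * j) * (u * (1 - u)\<^sup>2) ^ j))"
      unfolding sum_distrib_left
    proof (intro sum.cong refl)
      fix j assume "j \<in> {..h div 4}"
      then have "(1 + u) ^ h = (1 + u) ^ (h - 4 * j) * ((1 + u) ^ 4) ^ j"
        by (simp flip: power_mult power_add)
      then show "(1 + u) ^ h * (coeff R j * (u * (1 - u)\<^sup>2 / (1 + u) ^ 4) ^ j)
          = coeff R j * ((1 + u) ^ (h - 4 * j) * (u * (1 - u)\<^sup>2) ^ j)"
        using u by (simp add: power_divide)
    qed
    finally show "poly V u = (\<Sum>j\<le>h div 4. coeff R j * ((1 + u) ^ (h - 4 * j) * (u * (1 - u)\<^sup>2) ^ j))" .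
  qed
qed

text \<open>The shadow evaluates the expansion of \<open>V\<close> at u = -((1-y)/(1+y))^2. There
  (1+y)^2 (1+u) = 4y and (1+y)^8 u (1-u)^2 = -4 (1-y^4)^2, so each factor t brings a minus sign, and
  \<open>d j\<close> collects the powers of 4.\<close>

lemma code_shadow_expansion:
  obtains a d where
    "fps_of_poly V = (\<Sum>j\<le>h div 4. fps_const (a j) * code_term h j)"
    "\<And>i. fps_nth (\<Sum>j\<le>h div 4. fps_const ((-1) ^ j * a j * d j) * shadow_term h j) i \<ge> 0"
    "\<And>j. d j > 0"
proof -
  obtain a where a: "\<And>u. 1 + u \<noteq> 0 \<Longrightarrow>
    poly V u = (\<Sum>j\<le>h div 4. a j * ((1 + u) ^ (h - 4 * j) * (u * (1 - u)\<^sup>2) ^ j))"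
    using V_expansion by blast
  obtain S where S: "\<And>i. coeff S i \<ge> 0"
    "\<And>y. 1 + y \<noteq> 0 \<Longrightarrow> poly S y = (1 + y) ^ (2 * h) * poly V (- (((1 - y) / (1 + y))\<^sup>2))"
    using V_shadow by blast
  define d :: "nat \<Rightarrow> real" where "d j = 4 ^ h / 64 ^ j" for j
  have "V = (\<Sum>j\<le>h div 4. Polynomial.smult (a j) ([:1, 1:] ^ (h - 4 * j) * ([:0, 1:] * [:1, -1:]\<^sup>2) ^ j))"
    by (rule poly_eq_off_finite[of "{-1}"]) (subst a, auto simp: poly_sum add_eq_0_iff)
  then have "fps_of_poly V = fps_of_poly \<dots>" by simp
  also have "\<dots> = (\<Sum>j\<le>h div 4. fps_const (a j) * code_term h j)"
  proof -
    have "fps_of_poly [:1, -1:] = \<A>" "fps_of_poly [:1, 1:] = \<B>" "fps_of_poly [:0, 1:] = \<X>"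
      by (simp_all add: fps_of_poly_pCons flip: fps_const_neg)
    then show ?thesis
      by (simp only: fps_of_poly_sum fps_of_poly_smult fps_of_poly_mult fps_of_poly_power code_term_def)
  qed
  finally have 1: "fps_of_poly V = (\<Sum>j\<le>h div 4. fps_const (a j) * code_term h j)" .
  have "S = (\<Sum>j\<le>h div 4. Polynomial.smult ((-1) ^ j * a j * d j) (monom 1 (h - 4 * j) * (1 - monom 1 4) ^ (2 * j)))"
  proof (rule poly_eq_off_finite[of "{-1, 0}"])
    fix y :: real assume "y \<notin> {-1, 0}"
    then have y: "1 + y \<noteq> 0" "y \<noteq> 0" by auto
    define s where "s = ((1 - y) / (1 + y))\<^sup>2"
    have "(1 + y)\<^sup>2 * s = (1 - y)\<^sup>2" using y by (simp add: s_def power_divide)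
    then have s1: "(1 + y)\<^sup>2 * (1 - s) = 4 * y"
      unfolding right_diff_distrib by (simp add: power2_eq_square algebra_simps)
    have s2: "(1 + y) ^ 8 * (- s * (1 + s)\<^sup>2) = - 4 * (1 - y ^ 4)\<^sup>2"
    proof -
      have s0: "(1 + y)\<^sup>2 * s = (1 - y)\<^sup>2" using y by (simp add: s_def power_divide)
      then have "(1 + y)\<^sup>2 * (1 + s) = 2 * (1 + y\<^sup>2)"
        unfolding distrib_left by (simp add: power2_eq_square algebra_simps)
      moreover note s0
      moreover have "(1 + y) ^ 8 * (- s * (1 + s)\<^sup>2) = - (1 + y)\<^sup>2 * ((1 + y)\<^sup>2 * s) * ((1 + y)\<^sup>2 * (1 + s))\<^sup>2"
      proof -
        have "P ^ 4 * (- s * q\<^sup>2) = - P * (P * s) * (P * q)\<^sup>2" for P q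
          by (simp add: power2_eq_square power_numeral_reduce)
        from this[of "(1 + y)\<^sup>2" "1 + s"] show ?thesis by (simp flip: power_mult)
      qed
      moreover have "- (1 + y)\<^sup>2 * (1 - y)\<^sup>2 * (2 * (1 + y\<^sup>2))\<^sup>2 = - 4 * (1 - y ^ 4)\<^sup>2"
        by (simp add: power2_eq_square power_numeral_reduce algebra_simps)
      ultimately show ?thesis by simp
    qed
    have "1 + (- s) \<noteq> 0" using s1 y by auto
    have "poly S y = (1 + y) ^ (2 * h) * poly V (- s)" using S(2)[OF y(1)] by (simp add: s_def)
    also have "\<dots> = (\<Sum>j\<le>h div 4. (1 + y) ^ (2 * h) * (a j * ((1 + (- s)) ^ (h - 4 * j) * (- s * (1 - (- s))\<^sup>2) ^ j)))"
      unfolding a[OF \<open>1 + (- s) \<noteq> 0\<close>] by (rule sum_distrib_left)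
    also have "\<dots> = (\<Sum>j\<le>h div 4. (-1) ^ j * a j * d j * (y ^ (h - 4 * j) * (1 - y ^ 4) ^ (2 * j)))"
    proof (intro sum.cong refl)
      fix j assume "j \<in> {..h div 4}"
      then have hj: "2 * h = 2 * (h - 4 * j) + 8 * j" by simp
      then have "(1 + y) ^ (2 * h) = ((1 + y)\<^sup>2) ^ (h - 4 * j) * ((1 + y) ^ 8) ^ j"
        unfolding power_mult[symmetric] power_add[symmetric] by simp
      then have "(1 + y) ^ (2 * h) * (a j * ((1 + (- s)) ^ (h - 4 * j) * (- s * (1 - (- s))\<^sup>2) ^ j))
        = a j * (((1 + y)\<^sup>2 * (1 - s)) ^ (h - 4 * j) * ((1 + y) ^ 8 * (- s * (1 + s)\<^sup>2)) ^ j)"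
        unfolding power_mult_distrib by simp
      also have "\<dots> = a j * (4 ^ (h - 4 * j) * (- 4) ^ j) * (y ^ (h - 4 * j) * (1 - y ^ 4) ^ (2 * j))"
        unfolding s1 s2 power_mult[of _ 2 j] by (simp only: power_mult_distrib mult_ac)
      also have "4 ^ (h - 4 * j) * (- 4 :: real) ^ j = (-1) ^ j * d j"
      proof -
        have "h = (h - 4 * j) + 4 * j" using hj by simp
        then have "(4 :: real) ^ h = 4 ^ (h - 4 * j) * (4 ^ 4) ^ j"
          unfolding power_mult[symmetric] power_add[symmetric] by simp
        moreover have "(- 4 :: real) ^ j = (-1) ^ j * 4 ^ j" by (simp flip: power_mult_distrib)
        moreover have "(4 ^ 4 :: real) ^ j = 64 ^ j * 4 ^ j" by (simp flip: power_mult_distrib)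
        ultimately show ?thesis by (simp add: d_def)
      qed
      finally show "(1 + y) ^ (2 * h) * (a j * ((1 + (- s)) ^ (h - 4 * j) * (- s * (1 - (- s))\<^sup>2) ^ j))
        = (-1) ^ j * a j * d j * (y ^ (h - 4 * j) * (1 - y ^ 4) ^ (2 * j))" by simp
    qed
    finally show "poly S y = poly (\<Sum>j\<le>h div 4. Polynomial.smult ((-1) ^ j * a j * d j) (monom 1 (h - 4 * j) * (1 - monom 1 4) ^ (2 * j))) y"
      by (simp add: poly_sum poly_monom)
  qed simp
  then have "fps_of_poly S = fps_of_poly \<dots>" by simp
  also have "\<dots> = (\<Sum>j\<le>h div 4. fps_const ((-1) ^ j * a j * d j) * shadow_term h j)"
    by (simp add: fps_of_poly_sum fps_of_poly_smult fps_of_poly_mult fps_of_poly_power fps_of_poly_diff fps_of_poly_monom' shadow_term_def)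
  finally have 2: "fps_of_poly S = (\<Sum>j\<le>h div 4. fps_const ((-1) ^ j * a j * d j) * shadow_term h j)" .
  show ?thesis
  proof (rule that[of a d, OF 1])
    show "fps_nth (\<Sum>j\<le>h div 4. fps_const ((-1) ^ j * a j * d j) * shadow_term h j) i \<ge> 0" for i
      unfolding 2[symmetric] using S(1) by simp
  qed (simp add: d_def)
qed

text \<open>Words of weight \<open>2 * i\<close> meet coefficient \<open>J + 1 - i\<close> of the
  kernel, so weights above \<open>2 * (J + 1)\<close> never enter. Here \<open>\<delta>\<close> is
  half the minimum weight in absolute terms, not relative to the length.\<close>

lemma linear_programming_bound:
  assumes J: "4 * (J + 1) \<le> h" "even J" and c: "c \<ge> 0"
    and gap: "\<And>Y. Y \<in> C \<Longrightarrow> Y \<noteq> {} \<Longrightarrow> real (card Y) \<ge> 2 * \<delta>"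
    and top: "fps_nth (\<Omega> c * \<Phi> (2 * J + 3) (h + 1 - 4 * J)) (J + 1) > 0"
    and low: "\<And>k. real k \<le> J + 1 - \<delta> \<Longrightarrow> fps_nth (\<Omega> c * \<Phi> (2 * J + 3) (h + 1 - 4 * J)) k \<ge> 0"
  shows False
proof -
  define H where "H = \<Omega> c * \<Phi> (2 * J + 3) (h + 1 - 4 * J)"
  obtain a d where
    V: "fps_of_poly V = (\<Sum>j\<le>h div 4. fps_const (a j) * code_term h j)" and
    S: "\<And>i. fps_nth (\<Sum>j\<le>h div 4. fps_const ((-1) ^ j * a j * d j) * shadow_term h j) i \<ge> 0" and
    d: "\<And>j. d j > 0"
    using code_shadow_expansion by blast
  have "fps_nth (fps_of_poly V * H) (J + 1) \<le> 0"
    using code_functional_nonpos[OF J c V S d] by (simp add: H_def mult_ac)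
  moreover have "fps_nth (fps_of_poly V * H) (J + 1)
      = fps_nth H (J + 1) + (\<Sum>i=1..J + 1. coeff V i * fps_nth H (J + 1 - i))"
    unfolding fps_mult_nth by (subst sum.atLeast_Suc_atMost) (simp_all add: coeff_V_0)
  moreover have "(\<Sum>i=1..J + 1. coeff V i * fps_nth H (J + 1 - i)) \<ge> 0"
  proof (rule sum_nonneg)
    fix i assume i: "i \<in> {1..J + 1}"
    show "coeff V i * fps_nth H (J + 1 - i) \<ge> 0"
    proof (cases "\<exists>Y\<in>C. card Y = 2 * i")
      case True
      then have "real i \<ge> \<delta>" using gap i by force
      then have "fps_nth H (J + 1 - i) \<ge> 0" unfolding H_def using i by (intro low) auto
      then show ?thesis by (simp add: coeff_V)
    next
      case False
      then have "coeff V i = 0" unfolding coeff_V by simp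
      then show ?thesis by simp
    qed
  qed
  ultimately show False using top by (simp add: H_def)
qed

end

section \<open>Asymptotics of the linear functional\<close>

definition \<Omega>_poly :: "real \<Rightarrow> real poly" where
  "\<Omega>_poly c = [:1, -6, 1:] * [:1, 4 - c, 6 + 2 * c, 4 - c, 1:]"

lemma degree_\<Omega>_poly: "degree (\<Omega>_poly c) \<le> 6"
  unfolding \<Omega>_poly_def by (rule order_trans[OF degree_mult_le]) simp

lemma coeff_\<Omega>_poly_0: "coeff (\<Omega>_poly c) 0 = 1"
  by (simp add: \<Omega>_poly_def)

lemma poly_\<Omega>_poly: "poly (\<Omega>_poly c) u = (1 - 6 * u + u\<^sup>2) * ((1 + u) ^ 4 - c * (u * (1 - u)\<^sup>2))"
  by (simp add: \<Omega>_poly_def algebra_simps power2_eq_square power_numeral_reduce)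

lemma fps_of_poly_\<Omega>_poly: "fps_of_poly (\<Omega>_poly c) = \<Omega> c"
proof -
  have "\<Omega>_poly c = (1 - 6 * [:0, 1:] + [:0, 1:]\<^sup>2) * ([:1, 1:] ^ 4 - Polynomial.smult c ([:0, 1:] * (1 - [:0, 1:])\<^sup>2))"
    by (intro poly_eq_poly_eq_iff[THEN iffD1] ext) (simp add: poly_\<Omega>_poly mult_ac)
  moreover have "fps_of_poly [:1, 1:] = \<B>" "fps_of_poly [:0, 1:] = \<X>"
    by (simp_all add: fps_of_poly_pCons)
  ultimately show ?thesis
    unfolding \<Omega>_def by (simp only: fps_of_poly_mult fps_of_poly_add fps_of_poly_diff fps_of_poly_power
      fps_of_poly_smult fps_of_poly_numeral fps_of_poly_1)
qed

lemma inverse_fourth_root_5: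
  defines "b \<equiv> 5 powr (- 1 / 4) :: real"
  shows "b\<^sup>2 = 1 / sqrt 5" "2 / 3 < b" "b < 1"
proof -
  have e: "(1 / sqrt 5)\<^sup>2 = 1 / 5" by (simp add: power_divide)
  have "b\<^sup>2 = 5 powr (- (1 / 2))"
    unfolding b_def power2_eq_square powr_add[symmetric] by simp
  also have "\<dots> = 1 / sqrt 5" unfolding powr_minus_divide by (simp add: powr_half_sqrt)
  finally show be: "b\<^sup>2 = 1 / sqrt 5" .
  \<comment> \<open>That is 16/81 < 1/5, a narrow margin. The resulting \<open>b > 2 / 3\<close>
    says that (1 - b)/2 lies below 1/6.\<close>
  have "4 / 9 < 1 / sqrt 5" by (rule power2_less_imp_less) (use e in \<open>simp_all add: power_divide\<close>)
  then show "2 / 3 < b"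
    by (intro power2_less_imp_less[of "2 / 3" b]) (simp_all only: be, simp_all add: power_divide b_def)
  show "b < 1" using powr_less_mono[of "- 1 / 4" 0 5] by (simp add: b_def)
qed

text \<open>The saddle points \<open>1 / sqrt 5\<close> and \<open>((1 - b) / (1 + b))\<^sup>2\<close>, \<open>b = 5 powr (-1/4)\<close>, give the same value of
  \<open>t = u(1-u)\<^sup>2/(1+u)\<^sup>4\<close>. The relation of the second one with \<open>\<delta>\<close> is where the constant comes from.\<close>

lemma multiplier_exists:
  assumes "\<delta> > (1 - 5 powr (- 1 / 4)) / 2" "\<delta> < 1 / 6"
  obtains c u0 where "c \<ge> 0" "poly (\<Omega>_poly c) (1 / sqrt 5) > 0" "u0 > 0" "u0 < 1" "(1 - 6 * \<delta>) / (5 - 6 * \<delta>) < u0\<^sup>2"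
    "\<And>u. 0 \<le> u \<Longrightarrow> u \<le> u0 \<Longrightarrow> poly (\<Omega>_poly c) u > 0"
proof -
  define b :: real where "b = 5 powr (- 1 / 4)"
  define e :: real where "e = 1 / sqrt 5"
  define r where "r = ((1 - b) / (1 + b))\<^sup>2"
  \<comment> \<open>At half weight \<delta> h the kernel index is about (1/6 - \<delta>) h, and
    there the lower bound for the squared ratio tends to 1/v.\<close>
  define v where "v = (1 - 6 * \<delta>) / (5 - 6 * \<delta>)"
  \<comment> \<open>In this variable 1/t = (\<sigma> + 4)^2 / \<sigma> =
    \<open>G (\<sigma> u)\<close> and 1 - 6u + u^2 = u (\<sigma> - 4). \<open>G\<close> is invariant
    under \<sigma> -> 16/\<sigma>, whose fixed point 4 is its minimum and the zero of the
    quadratic.\<close>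
  define \<sigma> where "\<sigma> u = (1 - u)\<^sup>2 / u" for u :: real
  define G where "G s = s + 8 + 16 / s" for s :: real
  have b0: "b > 0" by (simp add: b_def)
  have be: "b\<^sup>2 = e" and b23: "2 / 3 < b" and b1: "b < 1"
    using inverse_fourth_root_5 by (simp_all only: b_def e_def)
  have e0: "e > 0" and e2: "e\<^sup>2 = 1 / 5" by (simp_all add: e_def power_divide)
  have e_bd: "4 / 9 < e" "e < 9 / 20"
  proof -
    show "4 / 9 < e" by (rule power2_less_imp_less) (use e0 e2 in \<open>simp_all add: power_divide\<close>)
    show "e < 9 / 20" by (rule power2_less_imp_less) (use e0 e2 in \<open>simp_all add: power_divide\<close>)
  qed
  have r0: "r > 0" "r < 1"
    using b0 b1 by (simp_all add: r_def power_less_one_iff abs_square_less_1)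
  have v0: "v > 0" using assms by (simp add: v_def)
  \<comment> \<open>Equality would hold at \<delta> = (1 - b)/2: there 1 - 6 \<delta> = 3b - 2 and 5
    - 6 \<delta> = 3b + 2, and r^2 = (3b - 2)/(3b + 2) amounts to 5 b^4 = 1.\<close>
  have vr: "v < r\<^sup>2"
  proof -
    have b4: "b ^ 4 = 1 / 5" using e2 by (simp flip: be power_mult)
    have "(3 * b + 2) * (1 - b) ^ 4 - (3 * b - 2) * (1 + b) ^ 4 = 4 - 20 * b ^ 4"
      by (simp add: algebra_simps power_numeral_reduce)
    then have "(3 * b + 2) * (1 - b) ^ 4 = (3 * b - 2) * (1 + b) ^ 4" by (simp add: b4)
    then have "(1 - b) ^ 4 / (1 + b) ^ 4 = (3 * b - 2) / (3 * b + 2)"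
      using b0 by (subst frac_eq_eq) (simp_all add: mult.commute)
    then have rb: "r\<^sup>2 = (3 * b - 2) / (3 * b + 2)"
      by (simp add: r_def power_divide flip: power_mult)
    define x y where "x = 1 - 6 * \<delta>" and "y = 3 * b - 2"
    have "0 < x" "x < y" using assms b23 by (simp_all add: x_def y_def b_def)
    then have "x / (x + 4) < y / (y + 4)" by (simp add: field_simps)
    then have "v < (3 * b - 2) / (3 * b + 2)" by (simp add: x_def y_def v_def add.commute)
    then show ?thesis by (simp add: rb)
  qed
  \<comment> \<open>Being below \<open>r\<close> leaves room for \<open>c\<close>; being above
    \<open>sqrt v\<close> leaves room for the limit process in the ratios.\<close>
  define u0 where "u0 = (sqrt v + r) / 2"
  have svr: "sqrt v < r" using vr r0 by (intro real_less_lsqrt) auto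
  have u0: "u0 > 0" "u0 < r" "v < u0\<^sup>2"
  proof -
    show "u0 > 0" "u0 < r" using svr v0 r0 by (simp_all add: u0_def add_pos_pos)
    have "sqrt v < u0" using svr by (simp add: u0_def)
    then have "(sqrt v)\<^sup>2 < u0\<^sup>2" using v0 by (intro power_strict_mono) auto
    then show "v < u0\<^sup>2" using v0 by simp
  qed
  have \<sigma>_anti: "\<sigma> y < \<sigma> x" if "0 < x" "x < y" "y < 1" for x y
  proof -
    have "(1 - y)\<^sup>2 < (1 - x)\<^sup>2" using that by (intro power_strict_mono) auto
    then have "(1 - y)\<^sup>2 / y < (1 - x)\<^sup>2 / y" using that by (intro divide_strict_right_mono) auto
    also have "\<dots> \<le> (1 - x)\<^sup>2 / x" using that by (intro divide_left_mono) auto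
    finally show ?thesis by (simp add: \<sigma>_def)
  qed
  have G_mono: "G s < G t" if "4 \<le> s" "s < t" for s t
  proof -
    have "s * t > 4 * 4" using that by (intro mult_le_less_imp_less) auto
    then have "(t - s) * (1 - 16 / (s * t)) > 0" using that by (intro mult_pos_pos) (auto simp: field_simps)
    moreover have "G t - G s = (t - s) * (1 - 16 / (s * t))" using that by (simp add: G_def field_simps)
    ultimately show ?thesis by simp
  qed
  have quartic: "(1 + u) ^ 4 - c * (u * (1 - u)\<^sup>2) = u * (1 - u)\<^sup>2 * (G (\<sigma> u) - c)" if "0 < u" "u < 1" for u c
  proof -
    have s: "u * \<sigma> u = (1 - u)\<^sup>2" "u * (1 - u)\<^sup>2 * (16 / \<sigma> u) = 16 * u\<^sup>2"
      using that by (simp_all add: \<sigma>_def power2_eq_square)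
    have "u * (1 - u)\<^sup>2 * G (\<sigma> u) = (1 - u)\<^sup>2 * (u * \<sigma> u) + 8 * u * (1 - u)\<^sup>2 + u * (1 - u)\<^sup>2 * (16 / \<sigma> u)"
      unfolding G_def by (simp only: algebra_simps)
    also have "\<dots> = (1 + u) ^ 4"
      unfolding s by (simp add: algebra_simps power2_eq_square power_numeral_reduce)
    finally have "u * (1 - u)\<^sup>2 * G (\<sigma> u) = (1 + u) ^ 4" .
    then show ?thesis by (simp add: algebra_simps)
  qed
  have quadratic: "1 - 6 * u + u\<^sup>2 = u * (\<sigma> u - 4)" if "0 < u" for u
    using that by (simp add: \<sigma>_def field_simps power2_eq_square)
  have \<sigma>e: "0 < \<sigma> e" "\<sigma> e < 4"
  proof -
    show "0 < \<sigma> e" using e_bd by (simp add: \<sigma>_def)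
    have "u * (\<sigma> u - 4) < 0" if "u = e" for u
      unfolding that quadratic[OF e0, symmetric] e2 using e_bd by simp
    then show "\<sigma> e < 4" using e0 by (simp add: mult_less_0_iff)
  qed
  \<comment> \<open>So \<open>e\<close> and \<open>r\<close> are partners under the symmetry of
    \<open>G\<close>.\<close>
  have \<sigma>r: "\<sigma> r = 16 / \<sigma> e"
  proof -
    have "\<sigma> r = 16 * b\<^sup>2 / (1 - b\<^sup>2)\<^sup>2"
    proof -
      define w where "w = (1 - b) / (1 + b)"
      have w: "w * (1 + b) = 1 - b" using b0 by (simp add: w_def)
      have "(1 - w\<^sup>2) * (1 + b)\<^sup>2 = (1 + b)\<^sup>2 - (w * (1 + b))\<^sup>2"
        by (simp only: power_mult_distrib left_diff_distrib mult_1)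
      also have "\<dots> = 4 * b" unfolding w by (simp add: power2_eq_square algebra_simps)
      finally have 1: "1 - w\<^sup>2 = 4 * b / (1 + b)\<^sup>2" using b0 by (simp add: eq_divide_eq)
      have "w\<^sup>2 = (1 - b)\<^sup>2 / (1 + b)\<^sup>2" by (simp add: w_def power_divide)
      have "\<sigma> r = (1 - w\<^sup>2)\<^sup>2 / w\<^sup>2" by (simp add: \<sigma>_def r_def w_def)
      also have "\<dots> = (4 * b / (1 + b)\<^sup>2)\<^sup>2 / ((1 - b)\<^sup>2 / (1 + b)\<^sup>2)"
        unfolding 1 by (simp only: \<open>w\<^sup>2 = (1 - b)\<^sup>2 / (1 + b)\<^sup>2\<close>)
      also have "\<dots> = 16 * b\<^sup>2 / ((1 - b) * (1 + b))\<^sup>2"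
      proof -
        have "(4 * b / P\<^sup>2)\<^sup>2 / (Q\<^sup>2 / P\<^sup>2) = 16 * b\<^sup>2 / (Q * P)\<^sup>2" if "P \<noteq> 0" "Q \<noteq> 0" for P Q
          using that by (simp add: field_simps power2_eq_square)
        then show ?thesis using b0 b1 by simp
      qed
      also have "(1 - b) * (1 + b) = 1 - b\<^sup>2" by (simp add: power2_eq_square algebra_simps)
      finally show ?thesis .
    qed
    then show ?thesis unfolding be by (simp add: \<sigma>_def)
  qed
  \<comment> \<open>A value strictly between makes both factors of \<open>\<Omega>\<close> negative
    at \<open>e\<close> and both positive on the interval from 0 to \<open>u0\<close>.\<close>
  define c where "c = (G (\<sigma> e) + G (\<sigma> u0)) / 2"
  have "\<sigma> r < \<sigma> u0" using u0 r0 by (intro \<sigma>_anti) auto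
  moreover have "4 \<le> \<sigma> r" unfolding \<sigma>r using \<sigma>e by (simp add: field_simps)
  ultimately have "G (\<sigma> r) < G (\<sigma> u0)" and s4: "4 < \<sigma> u0"
    using G_mono[of "\<sigma> r" "\<sigma> u0"] by linarith+
  moreover have "G (\<sigma> r) = G (\<sigma> e)" unfolding \<sigma>r G_def using \<sigma>e by simp
  ultimately have c: "G (\<sigma> e) < c" "c < G (\<sigma> u0)" by (simp_all add: c_def)
  show ?thesis
  proof (rule that[of c u0])
    have "G (\<sigma> e) \<ge> 0" using \<sigma>e by (simp add: G_def)
    then show "c \<ge> 0" using c(1) by simp
    show "u0 > 0" "u0 < 1" using u0 r0 by auto
    show "(1 - 6 * \<delta>) / (5 - 6 * \<delta>) < u0\<^sup>2" using u0(3) by (simp add: v_def)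
    have "poly (\<Omega>_poly c) e = (e * (\<sigma> e - 4)) * (e * (1 - e)\<^sup>2 * (G (\<sigma> e) - c))"
      unfolding poly_\<Omega>_poly using quartic[of e c] quadratic[of e] e_bd by simp
    also have "\<dots> > 0"
      using \<sigma>e c e_bd by (intro mult_neg_neg[of "e * _" "e * _ * _"] mult_pos_neg[of "e * _"] mult_pos_neg[of e]) auto
    finally show "poly (\<Omega>_poly c) (1 / sqrt 5) > 0" by (simp add: e_def)
    fix u assume u: "0 \<le> u" "u \<le> u0"
    show "poly (\<Omega>_poly c) u > 0"
    proof (cases "u = 0")
      case True
      then show ?thesis by (simp add: poly_\<Omega>_poly)
    next
      case False
      then have u': "0 < u" "u < 1" using u u0 r0 by auto
      have "\<sigma> u0 \<le> \<sigma> u" using \<sigma>_anti[of u u0] u u' u0 r0 by (cases "u = u0") auto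
      then have "4 < \<sigma> u" "G (\<sigma> u0) \<le> G (\<sigma> u)"
        using s4 G_mono[of "\<sigma> u0" "\<sigma> u"] by (auto simp: le_less)
      then show ?thesis
        unfolding poly_\<Omega>_poly quartic[OF u'] quadratic[OF u'(1)] using c u'
        by (intro mult_pos_pos) auto
    qed
  qed
qed

section \<open>Eventual signs of the kernel coefficients\<close>

lemma \<Phi>_three_term:
  assumes "4 * J \<le> h + 1" "6 * J \<ge> h" "m = real h + 4 - 2 * real J" "p = 6 * real J + 2 - real h"
    "m \<ge> 8" "p\<^sup>2 \<ge> 2 * (m + real E)"
  shows "three_term (fps_nth (\<Phi> (2 * J + 3) (h + 1 - 4 * J))) p m E"
proof -
  define N where "N = 2 * J + 3"
  define Q where "Q = h + 1 - 4 * J"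
  have "real h + 1 - 4 * real J = real Q" using assms(1) by (simp add: Q_def of_nat_diff)
  then have pm: "p = real N - real Q" "m = real N + real Q" using assms(3,4) by (simp_all add: N_def)
  have "h \<le> 6 * J + 1" using assms by simp
  then show ?thesis
    unfolding N_def[symmetric] Q_def[symmetric]
    using assms(2-) \<Phi>_rec[of _ N Q] by unfold_locales (auto simp: \<Phi>_0 \<Phi>_1[unfolded One_nat_def] pm)
qed

lemma asymptotic_signs:
  fixes \<delta> :: real
  assumes "\<delta> > (1 - 5 powr (- 1 / 4)) / 2" "\<delta> < 1 / 6"
  obtains c where "c \<ge> 0"
    "eventually (\<lambda>h. \<exists>J. even J \<and> 4 * (J + 1) \<le> h \<and>
       fps_nth (\<Omega> c * \<Phi> (2 * J + 3) (h + 1 - 4 * J)) (J + 1) > 0 \<and>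
       (\<forall>k. real k \<le> J + 1 - \<delta> * h \<longrightarrow> fps_nth (\<Omega> c * \<Phi> (2 * J + 3) (h + 1 - 4 * J)) k \<ge> 0)) sequentially"
proof -
  obtain c u0 where c: "c \<ge> 0" and top: "poly (\<Omega>_poly c) (1 / sqrt 5) > 0"
    and u0: "u0 > 0" "u0 < 1" "(1 - 6 * \<delta>) / (5 - 6 * \<delta>) < u0\<^sup>2"
    and low: "\<And>u. 0 \<le> u \<Longrightarrow> u \<le> u0 \<Longrightarrow> poly (\<Omega>_poly c) u > 0"
    using multiplier_exists[OF assms] by metis
  define W where "W = \<Omega>_poly c"
  define M where "M = (\<Sum>i\<le>6. \<bar>coeff W i\<bar>)"
  have M0: "M \<ge> 0" unfolding M_def by (intro sum_nonneg) auto
  have "\<exists>x\<in>{0..u0}. \<forall>y\<in>{0..u0}. poly W x \<le> poly W y"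
    by (rule continuous_attains_inf) (use u0 in \<open>auto intro!: continuous_intros\<close>)
  then obtain \<eta> where \<eta>: "\<eta> > 0" "\<And>u. 0 \<le> u \<Longrightarrow> u \<le> u0 \<Longrightarrow> \<eta> \<le> poly W u"
    using low unfolding W_def by (metis atLeastAtMost_iff)
  \<comment> \<open>Beyond \<open>K\<close> the error \<open>15 / k * M\<close> in
    \<open>conv_poly_lower\<close> is smaller than the minimum \<open>\<eta>\<close>.\<close>
  obtain K where K: "real K > 15 * M / \<eta>" using reals_Archimedean2 by blast
  \<comment> \<open>The outer factor 2 makes \<open>J h\<close> even. The square root yields
    \<open>(p h)\<^sup>2 \<ge> 144 * h\<close>, which covers \<open>p_sq\<close>, without changing
    the limit of \<open>J h / h\<close>.\<close>
  define J where "J h = 2 * nat \<lceil>real h / 12 + sqrt (real h)\<rceil>" for h :: nat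
  define p where "p h = 6 * real (J h) + 2 - real h" for h
  define m where "m h = real h + 4 - 2 * real (J h)" for h
  define g where "g h = fps_nth (\<Phi> (2 * J h + 3) (h + 1 - 4 * J h))" for h
  \<comment> \<open>The zero word corresponds to \<open>k = J h + 1\<close>, and
    \<open>conv_poly_lower\<close> uses the ratio of index \<open>k - 1\<close>.\<close>
  define r where "r h = three_term.\<rho> (g h) (J h)" for h
  have J_lower: "real h / 6 + 2 * sqrt (real h) \<le> real (J h)" for h
    using real_nat_ceiling_ge[of "real h / 12 + sqrt (real h)"]
    unfolding J_def of_nat_mult of_nat_numeral by linarith
  have J_upper: "real (J h) \<le> real h / 6 + 2 * sqrt (real h) + 2" for h
  proof -
    define x where "x = real h / 12 + sqrt (real h)"
    have "0 \<le> \<lceil>x\<rceil>" by (simp add: x_def le_ceiling_iff add_nonneg_nonneg order.strict_trans2[of _ 0])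
    then have "real (nat \<lceil>x\<rceil>) \<le> x + 1" using of_int_ceiling_le_add_one[of x] by simp
    moreover have "real (J h) = 2 * real (nat \<lceil>x\<rceil>)" by (simp add: J_def x_def)
    ultimately have "real (J h) \<le> 2 * (x + 1)" by (simp only: mult_le_cancel_left_pos)
    then show ?thesis by (simp add: x_def)
  qed
  have x_lim: "(\<lambda>h. real (J h) / real h) \<longlonglongrightarrow> 1 / 6"
  proof (rule tendsto_sandwich)
    show "(\<lambda>h. (real h / 6 + 2 * sqrt (real h)) / real h) \<longlonglongrightarrow> 1 / 6" by real_asymp
    show "(\<lambda>h. (real h / 6 + 2 * sqrt (real h) + 2) / real h) \<longlonglongrightarrow> 1 / 6" by real_asymp
  qed (use J_lower J_upper in \<open>auto intro!: always_eventually divide_right_mono\<close>)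
  have inv_lim: "(\<lambda>h. C / real h) \<longlonglongrightarrow> 0" for C by real_asymp
  have ev_pos: "eventually (\<lambda>h. h > 0) sequentially" by (rule eventually_gt_at_top)
  have "eventually (\<lambda>h. 4 * (real h / 6 + 2 * sqrt (real h) + 3) \<le> real h) sequentially" by real_asymp
  then have ev_J: "eventually (\<lambda>h. 4 * (J h + 1) \<le> h) sequentially"
  proof eventually_elim
    case (elim h)
    then have "real (4 * (J h + 1)) \<le> real h" using J_upper[of h] by simp
    then show ?case by linarith
  qed
  have ev_m: "eventually (\<lambda>h. m h \<ge> B) sequentially" for B
  proof -
    have "eventually (\<lambda>h. real h + 4 - 2 * (real h / 6 + 2 * sqrt (real h) + 2) \<ge> B) sequentially" by real_asymp
    then show ?thesis
    proof eventually_elim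
      case (elim h)
      then show ?case using J_upper[of h] by (simp add: m_def)
    qed
  qed
  have ev_tt: "eventually (\<lambda>h. three_term (g h) (p h) (m h) (J h + 1)) sequentially"
    using ev_J ev_m[of 8] ev_pos
  proof eventually_elim
    case (elim h)
    have p12: "p h \<ge> 12 * sqrt (real h)" using J_lower[of h] by (simp add: p_def)
    then have "(12 * sqrt (real h))\<^sup>2 \<le> (p h)\<^sup>2" by (intro power_mono) auto
    then have psq: "144 * real h \<le> (p h)\<^sup>2" by (simp add: power_mult_distrib)
    have "real h \<le> real (6 * J h)"
      using J_lower[of h] real_sqrt_ge_zero[of "real h"] unfolding of_nat_mult of_nat_numeral by linarith
    then have "h \<le> 6 * J h" by linarith
    moreover have "2 * (m h + real (J h + 1)) \<le> (p h)\<^sup>2"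
      using psq elim by (simp add: m_def)
    ultimately show ?case
      unfolding g_def using elim by (intro \<Phi>_three_term) (auto simp: m_def p_def)
  qed
  have H: "fps_nth (\<Omega> c * \<Phi> (2 * J h + 3) (h + 1 - 4 * J h)) k = (\<Sum>i=0..k. coeff W i * g h (k - i))" for h k
    unfolding fps_of_poly_\<Omega>_poly[symmetric] fps_mult_nth g_def W_def by simp
  have ev_top: "eventually (\<lambda>h. fps_nth (\<Omega> c * \<Phi> (2 * J h + 3) (h + 1 - 4 * J h)) (J h + 1) > 0) sequentially"
  proof -
    \<comment> \<open>As m + J ~ 5h/6 and J ~ h/6, both \<open>lo\<close> and \<open>up\<close> tend
      to 5; \<open>b\<close> tends to 0 since p grows only like sqrt h. The two bounds then squeeze
      the ratio to sqrt 5.\<close>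
    define lo where "lo h = (m h + real (J h)) / (real (J h) + 2)" for h
    define b where "b h = p h / (real (J h) + 1)" for h
    define up where "up h = (m h + real (J h) - 1) / (real (J h) + 1)" for h
    have lo: "lo \<longlonglongrightarrow> 5"
    proof (rule Lim_transform_eventually)
      show "(\<lambda>h. (1 + 4 / real h - real (J h) / real h) / (real (J h) / real h + 2 / real h)) \<longlonglongrightarrow> 5"
        using tendsto_divide[OF tendsto_diff[OF tendsto_add[OF tendsto_const[of 1] inv_lim[of 4]] x_lim]
            tendsto_add[OF x_lim inv_lim[of 2]]] by simp
      show "eventually (\<lambda>h. (1 + 4 / real h - real (J h) / real h) / (real (J h) / real h + 2 / real h) = lo h) sequentially"
        using ev_pos
      proof eventually_elim
        case (elim h)
        have "1 + 4 / real h - real (J h) / real h = (m h + real (J h)) / real h"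
          "real (J h) / real h + 2 / real h = (real (J h) + 2) / real h"
          using elim by (simp_all add: m_def field_simps)
        then show ?case using elim by (simp add: lo_def)
      qed
    qed
    have up: "up \<longlonglongrightarrow> 5"
    proof (rule Lim_transform_eventually)
      show "(\<lambda>h. (1 + 3 / real h - real (J h) / real h) / (real (J h) / real h + 1 / real h)) \<longlonglongrightarrow> 5"
        using tendsto_divide[OF tendsto_diff[OF tendsto_add[OF tendsto_const[of 1] inv_lim[of 3]] x_lim]
            tendsto_add[OF x_lim inv_lim[of 1]]] by simp
      show "eventually (\<lambda>h. (1 + 3 / real h - real (J h) / real h) / (real (J h) / real h + 1 / real h) = up h) sequentially"
        using ev_pos
      proof eventually_elim
        case (elim h)
        have "1 + 3 / real h - real (J h) / real h = (m h + real (J h) - 1) / real h"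
          "real (J h) / real h + 1 / real h = (real (J h) + 1) / real h"
          using elim by (simp_all add: m_def field_simps)
        then show ?case using elim by (simp add: up_def)
      qed
    qed
    have b: "b \<longlonglongrightarrow> 0"
    proof (rule Lim_transform_eventually)
      show "(\<lambda>h. (6 * (real (J h) / real h) + 2 / real h - 1) / (real (J h) / real h + 1 / real h)) \<longlonglongrightarrow> 0"
        using tendsto_divide[OF tendsto_diff[OF tendsto_add[OF tendsto_mult[OF tendsto_const[of 6] x_lim] inv_lim[of 2]] tendsto_const[of 1]]
            tendsto_add[OF x_lim inv_lim[of 1]]] by simp
      show "eventually (\<lambda>h. (6 * (real (J h) / real h) + 2 / real h - 1) / (real (J h) / real h + 1 / real h) = b h) sequentially"
        using ev_pos
      proof eventually_elim
        case (elim h)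
        have "6 * (real (J h) / real h) + 2 / real h - 1 = p h / real h"
          "real (J h) / real h + 1 / real h = (real (J h) + 1) / real h"
          using elim by (simp_all add: p_def field_simps)
        then show ?case using elim by (simp add: b_def)
      qed
    qed
    have r_lim: "r \<longlonglongrightarrow> sqrt 5"
    proof (rule tendsto_sandwich)
      show "(\<lambda>h. sqrt (lo h)) \<longlonglongrightarrow> sqrt 5" by (intro tendsto_intros lo)
      have "(\<lambda>h. b h / 2 + sqrt ((b h)\<^sup>2 / 4 + up h)) \<longlonglongrightarrow> 0 / 2 + sqrt (0\<^sup>2 / 4 + 5)"
        by (intro tendsto_intros b up) simp_all
      then show "(\<lambda>h. b h / 2 + sqrt ((b h)\<^sup>2 / 4 + up h)) \<longlonglongrightarrow> sqrt 5" by simp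
      show "eventually (\<lambda>h. sqrt (lo h) \<le> r h) sequentially"
        using ev_tt
      proof eventually_elim
        case (elim h)
        then interpret three_term "g h" "p h" "m h" "J h + 1" .
        show ?case
          unfolding lo_def r_def using \<rho>_sq_lower[of "J h"] less_imp_le[OF \<rho>_pos[of "J h"]]
          by (intro real_le_lsqrt) auto
      qed
      show "eventually (\<lambda>h. r h \<le> b h / 2 + sqrt ((b h)\<^sup>2 / 4 + up h)) sequentially"
        using ev_tt
      proof eventually_elim
        case (elim h)
        then interpret three_term "g h" "p h" "m h" "J h + 1" .
        show ?case
          unfolding b_def up_def r_def by (rule \<rho>_upper) simp
      qed
    qed
    have "(\<lambda>h. poly W (1 / r h) - 15 / real (J h + 1) * M) \<longlonglongrightarrow> poly W (1 / sqrt 5) - 0 * M"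
    proof (intro tendsto_diff tendsto_mult tendsto_const)
      show "(\<lambda>h. poly W (1 / r h)) \<longlonglongrightarrow> poly W (1 / sqrt 5)"
        by (intro isCont_tendsto_compose[of _ "poly W"] tendsto_divide tendsto_const r_lim) auto
      show "(\<lambda>h. 15 / real (J h + 1)) \<longlonglongrightarrow> 0"
      proof (rule tendsto_sandwich[OF _ _ tendsto_const])
        show "(\<lambda>h. 90 / real h) \<longlonglongrightarrow> 0" by (rule inv_lim)
        show "eventually (\<lambda>h. 15 / real (J h + 1) \<le> 90 / real h) sequentially"
          using ev_pos
        proof eventually_elim
          case (elim h)
          have "real h / 6 \<le> real (J h + 1)"
            using J_lower[of h] real_sqrt_ge_zero[of "real h"] by linarith
          then show ?case using elim by (simp add: field_simps)
        qed
      qed auto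
    qed
    then have "eventually (\<lambda>h. poly W (1 / r h) - 15 / real (J h + 1) * M > 0) sequentially"
      by (rule order_tendstoD) (use top in \<open>simp add: W_def\<close>)
    then show ?thesis
      using ev_tt
    proof eventually_elim
      case (elim h)
      interpret three_term "g h" "p h" "m h" "J h + 1" by (rule elim(2))
      have "0 < g h (J h + 1) * (poly W (1 / r h) - 15 / real (J h + 1) * M)"
        using elim(1) g_pos by simp
      also have "\<dots> \<le> (\<Sum>i=0..J h + 1. coeff W i * g h (J h + 1 - i))"
        using conv_poly_lower(1)[of W "J h + 1"] degree_\<Omega>_poly \<rho>_ge_1[of "J h"]
        by (simp add: M_def r_def W_def)
      finally show ?case unfolding H .
    qed
  qed
  \<comment> \<open>The right side is the squared-ratio bound at the largest admissible
    \<open>k\<close>, where \<open>k + 1\<close> is at most \<open>J h + 2 - \<delta> * h\<close>.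
    It is smallest there, so this one limit, (5 - 6 \<delta>)/(1 - 6 \<delta>), covers all smaller
    \<open>k\<close>.\<close>
  have ev_ratio: "eventually (\<lambda>h. 1 / u0\<^sup>2 < 1 + (m h - 2) / (real (J h) + 2 - \<delta> * real h)) sequentially"
  proof -
    have lim: "(\<lambda>h. 1 + (1 + 2 / real h - 2 * (real (J h) / real h)) / (real (J h) / real h + 2 / real h - \<delta>))
        \<longlonglongrightarrow> 1 + (1 + 0 - 2 * (1 / 6)) / (1 / 6 + 0 - \<delta>)"
      by (intro tendsto_intros x_lim inv_lim) (use assms in simp)
    have "1 / u0\<^sup>2 < (5 - 6 * \<delta>) / (1 - 6 * \<delta>)"
    proof -
      have "1 / u0\<^sup>2 < 1 / ((1 - 6 * \<delta>) / (5 - 6 * \<delta>))"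
        using u0 assms by (intro divide_strict_left_mono) auto
      then show ?thesis by simp
    qed
    also have "\<dots> = 1 + (1 + 0 - 2 * (1 / 6)) / (1 / 6 + 0 - \<delta>)" using assms by (simp add: field_simps)
    finally have "eventually (\<lambda>h. 1 / u0\<^sup>2 < 1 + (1 + 2 / real h - 2 * (real (J h) / real h)) / (real (J h) / real h + 2 / real h - \<delta>)) sequentially"
      by (rule order_tendstoD(1)[OF lim])
    then show ?thesis
      using ev_pos
    proof eventually_elim
      case (elim h)
      have "1 + 2 / real h - 2 * (real (J h) / real h) = (m h - 2) / real h"
        "real (J h) / real h + 2 / real h - \<delta> = (real (J h) + 2 - \<delta> * real h) / real h"
        using elim by (simp_all add: m_def field_simps)
      then show ?case using elim by simp
    qed
  qed
  have ev_low: "eventually (\<lambda>h. \<forall>k. real k \<le> J h + 1 - \<delta> * h \<longrightarrow>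
      fps_nth (\<Omega> c * \<Phi> (2 * J h + 3) (h + 1 - 4 * J h)) k \<ge> 0) sequentially"
    using ev_tt ev_ratio ev_m[of "2 + M\<^sup>2 * (real K + 1)"]
  proof eventually_elim
    case (elim h)
    interpret three_term "g h" "p h" "m h" "J h + 1" by (rule elim(1))
    have W: "degree W \<le> 6" "coeff W 0 = 1" by (simp_all add: W_def degree_\<Omega>_poly coeff_\<Omega>_poly_0)
    show ?case
    proof (intro allI impI)
      fix k assume k: "real k \<le> J h + 1 - \<delta> * h"
      show "fps_nth (\<Omega> c * \<Phi> (2 * J h + 3) (h + 1 - 4 * J h)) k \<ge> 0"
      proof (cases "k = 0")
        case True
        then show ?thesis unfolding H using W g_pos[of 0] by simp
      next
        case False
        have "\<delta> > 0" using assms(1) inverse_fourth_root_5(3) by simp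
        then have "0 \<le> \<delta> * real h" by simp
        then have "real k \<le> real (J h + 1)" using k by linarith
        then have kE: "k \<le> Suc (Suc (J h + 1))" "k > 0" and k1: "k - 1 \<le> J h + 1" using False by simp_all
        define s where "s = \<rho> (k - 1)"
        have s: "s \<ge> 1" using \<rho>_ge_1[OF k1] by (simp add: s_def)
        have "m h + real (k - 1) = (real k + 1) + (m h - 2)" "real (k - 1) + 2 = real k + 1"
          using kE(2) by (simp_all add: of_nat_diff)
        then have "(m h + real (k - 1)) / (real (k - 1) + 2) = 1 + (m h - 2) / (real k + 1)"
          by (simp only: add_divide_distrib[of "real k + 1"] divide_self_if[of "real k + 1"]) simp
        then have s2: "1 + (m h - 2) / (real k + 1) \<le> s\<^sup>2" using \<rho>_sq_lower[OF k1] unfolding s_def by linarith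
        note cpl = conv_poly_lower[OF W(1) kE \<rho>_ge_1[OF k1], folded M_def s_def]
        show ?thesis
        \<comment> \<open>For \<open>k \<le> K\<close> the growth of \<open>m h\<close> forces
          \<open>s \<ge> M\<close>, so the constant coefficient 1 dominates. For larger
          \<open>k\<close> the point \<open>1 / s\<close> lies in the interval where
          \<open>W\<close> is at least \<open>\<eta>\<close>.\<close>
        proof (cases "k \<le> K")
          case True
          have "M\<^sup>2 \<le> (m h - 2) / (real k + 1)"
          proof -
            have "M\<^sup>2 * (real k + 1) \<le> M\<^sup>2 * (real K + 1)" using True by (intro mult_left_mono) auto
            then show ?thesis using elim(3) by (simp add: pos_le_divide_eq)
          qed
          then have "M\<^sup>2 \<le> s\<^sup>2" using s2 by linarith
          then have "M \<le> s" by (rule power2_le_imp_le) (use s in simp)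
          then have "0 \<le> g h k * (coeff W 0 - M / s)"
            using less_imp_le[OF g_pos[of k]] s W(2) by (intro mult_nonneg_nonneg) (simp_all add: divide_le_eq_1)
          then show ?thesis unfolding H by (rule order_trans[OF _ cpl(2)])
        next
          case False
          have "(m h - 2) / (real (J h) + 2 - \<delta> * real h) \<le> (m h - 2) / (real k + 1)"
            using k m_ge by (intro divide_left_mono mult_pos_pos) auto
          then have "1 / u0\<^sup>2 < s\<^sup>2" using elim(2) s2 by linarith
          then have "(1 / u0)\<^sup>2 < s\<^sup>2" by (simp add: power_divide)
          then have "1 / u0 < s" by (rule power2_less_imp_less) (use s in simp)
          then have "1 / s \<le> u0" using u0 s by (simp add: pos_divide_less_eq pos_divide_le_eq mult.commute)
          then have "\<eta> \<le> poly W (1 / s)" using s by (intro \<eta>) auto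
          moreover have "15 / real k * M \<le> \<eta>"
          proof -
            have "15 * M / \<eta> < real k" using K False by linarith
            then have "15 * M < real k * \<eta>" using \<eta>(1) by (simp only: pos_divide_less_eq)
            then show ?thesis using kE(2) by (simp add: pos_divide_le_eq mult.commute)
          qed
          ultimately have "0 \<le> g h k * (poly W (1 / s) - 15 / real k * M)"
            using less_imp_le[OF g_pos[of k]] by (intro mult_nonneg_nonneg) simp_all
          then show ?thesis unfolding H by (rule order_trans[OF _ cpl(1)])
        qed
      qed
    qed
  qed
  show ?thesis
  proof (rule that[OF c])
    show "eventually (\<lambda>h. \<exists>J. even J \<and> 4 * (J + 1) \<le> h \<and>
       fps_nth (\<Omega> c * \<Phi> (2 * J + 3) (h + 1 - 4 * J)) (J + 1) > 0 \<and>
       (\<forall>k. real k \<le> J + 1 - \<delta> * h \<longrightarrow> fps_nth (\<Omega> c * \<Phi> (2 * J + 3) (h + 1 - 4 * J)) k \<ge> 0)) sequentially"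
      using ev_J ev_top ev_low
    proof eventually_elim
      case (elim h)
      then show ?case by (intro exI[of _ "J h"]) (simp add: J_def)
    qed
  qed
qed

section \<open>Binary codes\<close>

definition support :: "binary_word \<Rightarrow> nat set" where
  "support x = {i. i < dim_vec x \<and> vec_index x i = 1}"

lemma of_nat_bit_eq_0_iff: "(of_nat k :: bit) = 0 \<longleftrightarrow> even k"
proof (cases "even k")
  case True
  then obtain j where "k = 2 * j" by (elim evenE)
  then have "(of_nat k :: bit) = 2 * of_nat j" by (simp only: of_nat_mult of_nat_numeral)
  then show ?thesis using True by (simp only: bit_2_eq_0 mult_zero_left simp_thms)
next
  case False
  then obtain j where "k = 2 * j + 1" by (elim oddE)
  then have "(of_nat k :: bit) = 2 * of_nat j + 1" by (simp only: of_nat_add of_nat_mult of_nat_numeral of_nat_1)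
  then have "(of_nat k :: bit) = 1" by (simp only: bit_2_eq_0 mult_zero_left add_0_left)
  then show ?thesis using False by (simp only: one_neq_zero simp_thms)
qed

lemma scalar_prod_eq_0_iff:
  fixes x y :: binary_word
  assumes "dim_vec x = dim_vec y"
  shows "scalar_prod x y = 0 \<longleftrightarrow> even (card (support x \<inter> support y))"
proof -
  have "scalar_prod x y = (\<Sum>i\<in>{0..<dim_vec y}. if i \<in> support x \<inter> support y then 1 else 0)"
    unfolding scalar_prod_def
  proof (intro sum.cong refl)
    fix i assume "i \<in> {0..<dim_vec y}"
    then show "vec_index x i * vec_index y i = (if i \<in> support x \<inter> support y then 1 else 0)"
      by (cases "vec_index x i = 1"; cases "vec_index y i = 1") (simp_all add: support_def assms)
  qed
  also have "\<dots> = (\<Sum>i\<in>{0..<dim_vec y} \<inter> (support x \<inter> support y). 1)"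
    by (rule sum.inter_restrict[symmetric]) simp
  also have "{0..<dim_vec y} \<inter> (support x \<inter> support y) = support x \<inter> support y"
    by (auto simp: support_def)
  finally show ?thesis by (simp add: of_nat_bit_eq_0_iff)
qed

lemma self_dual_sets_support:
  assumes "self_dual_code n C"
  shows "self_dual_sets n (support ` C)"
proof
  have C: "C = {x \<in> carrier_vec n. \<forall>c\<in>C. scalar_prod x c = 0}"
    using assms by (simp add: self_dual_code_iff dual_code_def)
  have dim: "dim_vec x = n" if "x \<in> C" for x
    using assms that by (auto simp: self_dual_code_def binary_linear_code_iff)
  show "support ` C = {Y. Y \<subseteq> {..<n} \<and> (\<forall>Z\<in>support ` C. even (card (Y \<inter> Z)))}"
  proof (intro equalityI subsetI)
    fix Y assume "Y \<in> support ` C"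
    then obtain x where x: "x \<in> C" "Y = support x" by blast
    have "even (card (support x \<inter> support c))" if "c \<in> C" for c
    proof -
      have "x \<in> {x \<in> carrier_vec n. \<forall>c\<in>C. scalar_prod x c = 0}" using x(1) by (rule equalityD1[OF C, THEN subsetD])
      then show ?thesis using that dim[OF x(1)] dim[OF that] scalar_prod_eq_0_iff[of x c] by simp
    qed
    then show "Y \<in> {Y. Y \<subseteq> {..<n} \<and> (\<forall>Z\<in>support ` C. even (card (Y \<inter> Z)))}"
      using x dim[OF x(1)] by (auto simp: support_def)
  next
    fix Y assume Y: "Y \<in> {Y. Y \<subseteq> {..<n} \<and> (\<forall>Z\<in>support ` C. even (card (Y \<inter> Z)))}"
    define x :: binary_word where "x = vec n (\<lambda>i. if i \<in> Y then 1 else 0)"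
    have sx: "support x = Y" using Y by (auto simp: support_def x_def split: if_splits)
    have "scalar_prod x c = 0" if "c \<in> C" for c
    proof -
      have "dim_vec x = dim_vec c" by (simp add: x_def dim[OF that])
      from scalar_prod_eq_0_iff[OF this] show ?thesis using Y that by (simp add: sx)
    qed
    then have "x \<in> C" by (subst C) (auto simp: x_def)
    then show "Y \<in> support ` C" using sx by blast
  qed
qed

text \<open>The weight of \<open>x\<close> is its distance from the zero word, hence one of the
  finitely many values under \<open>Min\<close>.\<close>

lemma minimum_distance_le_card_support:
  assumes "self_dual_code n C" "x \<in> C" "support x \<noteq> {}"
  shows "minimum_distance C \<le> card (support x)"
proof -
  have lin: "C \<subseteq> carrier_vec n" "0\<^sub>v n \<in> C"
    using assms(1) by (auto simp: self_dual_code_def binary_linear_code_iff)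
  have "hamming_distance a b \<le> n" if "a \<in> C" for a b
  proof -
    have "dim_vec a = n" using lin(1) that by auto
    then have "{i. i < dim_vec a \<and> vec_index a i \<noteq> vec_index b i} \<subseteq> {..<n}" by blast
    then show ?thesis using card_mono[OF finite_lessThan] by (fastforce simp: hamming_distance_def)
  qed
  then have "{hamming_distance a b | a b. a \<in> C \<and> b \<in> C \<and> a \<noteq> b} \<subseteq> {..n}" by blast
  then have fin: "finite {hamming_distance a b | a b. a \<in> C \<and> b \<in> C \<and> a \<noteq> b}"
    by (rule finite_subset) simp
  have dim: "dim_vec x = n" using assms(2) lin(1) by auto
  have "{i. i < dim_vec x \<and> vec_index x i \<noteq> vec_index (0\<^sub>v n) i} = support x"
    unfolding support_def by (intro Collect_cong conj_cong refl) (simp add: dim)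
  then have "card (support x) = hamming_distance x (0\<^sub>v n)"
    unfolding hamming_distance_def by simp
  moreover have "x \<noteq> 0\<^sub>v n" using assms(3) by (auto simp: support_def)
  ultimately have "card (support x) \<in> {hamming_distance a b | a b. a \<in> C \<and> b \<in> C \<and> a \<noteq> b}"
    using assms(2) lin(2) by blast
  then show ?thesis unfolding minimum_distance_def by (rule Min_le[OF fin])
qed

section \<open>The bound for sequences of codes\<close>

lemma eventually_minimum_distance_less:
  fixes C :: "nat \<Rightarrow> binary_word set"
    and n :: "nat \<Rightarrow> nat"
  assumes C: "\<And>i. self_dual_code (n i) (C i)"
    and n: "filterlim n at_top sequentially"
    and \<delta>: "\<delta> > (1 - 5 powr (- 1 / 4)) / 2" "\<delta> < 1 / 6"
  shows "eventually (\<lambda>i. real (minimum_distance (C i)) < \<delta> * real (n i)) sequentially"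
proof -
  obtain c where c: "c \<ge> 0" and ev:
    "eventually (\<lambda>h. \<exists>J. even J \<and> 4 * (J + 1) \<le> h \<and>
       fps_nth (\<Omega> c * \<Phi> (2 * J + 3) (h + 1 - 4 * J)) (J + 1) > 0 \<and>
       (\<forall>k. real k \<le> J + 1 - \<delta> * h \<longrightarrow> fps_nth (\<Omega> c * \<Phi> (2 * J + 3) (h + 1 - 4 * J)) k \<ge> 0)) sequentially"
    by (rule asymptotic_signs[OF \<delta>])
  have "filterlim (\<lambda>i. n i div 2) at_top sequentially"
    unfolding filterlim_at_top
  proof
    fix Z
    have "eventually (\<lambda>i. 2 * Z \<le> n i) sequentially" using n by (simp add: filterlim_at_top)
    then show "eventually (\<lambda>i. Z \<le> n i div 2) sequentially" by eventually_elim simp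
  qed
  from eventually_compose_filterlim[OF ev this] show ?thesis
  proof eventually_elim
    case (elim i)
    interpret self_dual_sets "n i" "support ` C i" by (rule self_dual_sets_support[OF C])
    obtain J where J: "even J" "4 * (J + 1) \<le> h"
       "fps_nth (\<Omega> c * \<Phi> (2 * J + 3) (h + 1 - 4 * J)) (J + 1) > 0"
       "\<forall>k. real k \<le> J + 1 - \<delta> * h \<longrightarrow> fps_nth (\<Omega> c * \<Phi> (2 * J + 3) (h + 1 - 4 * J)) k \<ge> 0"
      using elim unfolding h_def[symmetric] by (elim exE conjE) (rule that)
    show ?case
    proof (rule ccontr)
      assume "\<not> real (minimum_distance (C i)) < \<delta> * real (n i)"
      moreover have "real (n i) = 2 * real h" by (subst n_eq) simp
      ultimately have d: "2 * (\<delta> * real h) \<le> real (minimum_distance (C i))"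
        by (simp only: not_less mult.left_commute)
      show False
      proof (rule linear_programming_bound[OF J(2,1) c _ J(3) J(4)[rule_format]])
        fix Y assume "Y \<in> support ` C i" "Y \<noteq> {}"
        then obtain x where "x \<in> C i" "Y = support x" "support x \<noteq> {}" by blast
        then have "minimum_distance (C i) \<le> card Y"
          using minimum_distance_le_card_support[OF C] by simp
        then show "2 * (\<delta> * real h) \<le> real (card Y)" using d by linarith
      qed
    qed
  qed
qed

theorem theorem6:
  fixes C :: "nat \<Rightarrow> binary_word set"
    and n :: "nat \<Rightarrow> nat"
  assumes "\<And>i. self_dual_code (n i) (C i)"
    and "filterlim n at_top sequentially"
  shows "limsup (\<lambda>i. ereal (real (minimum_distance (C i)) / real (n i)))
           \<le> ereal ((1 - 5 powr (- 1 / 4)) / 2)"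
proof (rule ccontr)
  define \<beta> :: real where "\<beta> = (1 - 5 powr (- 1 / 4)) / 2"
  define L where "L = limsup (\<lambda>i. ereal (real (minimum_distance (C i)) / real (n i)))"
  assume "\<not> ?thesis"
  then have "ereal \<beta> < L" by (simp add: L_def \<beta>_def)
  then obtain d where "ereal \<beta> < ereal d" and "ereal d < L"
    using ereal_dense2[of "ereal \<beta>" L] by blast
  then have d: "\<beta> < d" "ereal d < L" by simp_all
  have "\<beta> < 1 / 6" using inverse_fourth_root_5(2) by (simp add: \<beta>_def)
  \<comment> \<open>The cap keeps \<open>\<delta>\<close> below 1/6, as the preceding lemma demands;
    being a midpoint it still exceeds \<open>\<beta>\<close>.\<close>
  define \<delta> where "\<delta> = min d ((\<beta> + 1 / 6) / 2)"
  have \<delta>: "\<delta> > \<beta>" "\<delta> < 1 / 6" "\<delta> \<le> d"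
    using d \<open>\<beta> < 1 / 6\<close> by (auto simp: \<delta>_def min_def)
  have "eventually (\<lambda>i. real (minimum_distance (C i)) < \<delta> * real (n i)) sequentially"
    using eventually_minimum_distance_less[OF assms] \<delta> by (simp add: \<beta>_def)
  moreover have "eventually (\<lambda>i. n i > 0) sequentially"
  proof -
    have "eventually (\<lambda>i. 1 \<le> n i) sequentially" using assms(2) by (simp add: filterlim_at_top)
    then show ?thesis by eventually_elim simp
  qed
  ultimately have "eventually (\<lambda>i. ereal (real (minimum_distance (C i)) / real (n i)) \<le> ereal \<delta>) sequentially"
    by eventually_elim (simp add: pos_divide_le_eq)
  then have "L \<le> ereal \<delta>" unfolding L_def by (rule Limsup_bounded)
  also have "\<dots> \<le> ereal d" using \<delta> by simp
  finally show False using d(2) by simp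
qed

end
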